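(* Let $(W,S)$ be an arbitrary (possibly infinite) Coxeter system. The facial weak order on the Davis complex $\mathcal D_W$ is a meet-semilattice, and the meet of two cosets $xW_I,yW_J\in\mathcal D_W$ (with $x\in W^I$, $y\in W^J$) is $xW_I\wedge yW_J=z_\wedge W_{K_\wedge}$, where $z_\wedge=x\wedge y$ and $K_\wedge=D_L\big(z_\wedge^{-1}(xw_{\circ,I}\wedge yw_{\circ,J})\big)$, meets of elements being taken in the right weak order on $W$.
   Context: $\ell$ is the length function of $(W,S)$; the right weak order on $W$ is $u\le v$ iff $\ell(u)+\ell(u^{-1}v)=\ell(v)$ (a meet-semilattice). For $I\subseteq S$, $W_I$ is the subgroup generated by $I$, $W^I=\{w:\ell(ws)>\ell(w)\ \forall s\in I\}$, and when $W_I$ is finite $w_{\circ,I}$ denotes its longest element. $D_L(w)=\{s\in S:\ell(sw)<\ell(w)\}$. The Davis complex is $\mathcal D_W=\bigcup_{I\subseteq S,\ W_I\text{ finite}}W/W_I$, each coset written $xW_I$ with $x\in W^I$. The facial weak order on $\mathcal D_W$ is defined by $xW_I\le yW_J$ iff $x\le y$ and $xw_{\circ,I}\le yw_{\circ,J}$ in the right weak order. *)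

theory Defs
  imports
    "HOL-Algebra.Generated_Groups"
    "HOL-Algebra.Left_Coset"
    "HOL-Algebra.Lattice"
    "HOL-Library.Extended_Nat"
begin

definition coxeter_matrix :: "'a set \<Rightarrow> ('a \<Rightarrow> 'a \<Rightarrow> enat) \<Rightarrow> bool" where
  "coxeter_matrix S m \<longleftrightarrow>
     (\<forall>s\<in>S. m s s = 1) \<and>
     (\<forall>s\<in>S. \<forall>t\<in>S. m s t = m t s \<and> (s \<noteq> t \<longrightarrow> 2 \<le> m s t))"

text \<open>
  The congruence on words over \<open>S\<close> generated by the relations \<open>(s t)\<^bsup>m s t\<^esup> = 1\<close> for all
  \<open>s, t \<in> S\<close> with \<open>m s t\<close> finite. For \<open>s = t\<close> the relator is the word \<open>s s\<close>, so every letter is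
  its own inverse and words without inverse letters suffice to present the group.
\<close>

inductive coxeter_cong :: "'a set \<Rightarrow> ('a \<Rightarrow> 'a \<Rightarrow> enat) \<Rightarrow> 'a list \<Rightarrow> 'a list \<Rightarrow> bool"
  for S :: "'a set" and m :: "'a \<Rightarrow> 'a \<Rightarrow> enat" where
  relator: "\<lbrakk>s \<in> S; t \<in> S; m s t = enat k; us \<in> lists S; vs \<in> lists S\<rbrakk>
    \<Longrightarrow> coxeter_cong S m (us @ concat (replicate k [s, t]) @ vs) (us @ vs)"
| refl: "us \<in> lists S \<Longrightarrow> coxeter_cong S m us us"
| sym: "coxeter_cong S m us vs \<Longrightarrow> coxeter_cong S m vs us"
| trans: "\<lbrakk>coxeter_cong S m us vs; coxeter_cong S m vs ws\<rbrakk> \<Longrightarrow> coxeter_cong S m us ws"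

definition word_prod :: "('a, 'b) monoid_scheme \<Rightarrow> 'a list \<Rightarrow> 'a" where
  "word_prod W us = foldr (\<otimes>\<^bsub>W\<^esub>) us \<one>\<^bsub>W\<^esub>"

text \<open>
  \<open>W = \<langle>S | (s t)\<^bsup>m s t\<^esup> = 1\<rangle>\<close> for some Coxeter matrix \<open>m\<close>: the set \<open>S\<close> generates \<open>W\<close>, and
  two words over \<open>S\<close> have the same product in \<open>W\<close> iff the defining relations identify them.
\<close>

locale coxeter_system = group W for W (structure) +
  fixes S :: "'a set"
  assumes S_subset: "S \<subseteq> carrier W"
    and generates: "generate W S = carrier W"
    and presentation: "\<exists>m. coxeter_matrix S m \<and>
      (\<forall>us \<in> lists S. \<forall>vs \<in> lists S.
         word_prod W us = word_prod W vs \<longleftrightarrow> coxeter_cong S m us vs)"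

definition cox_length :: "('a, 'b) monoid_scheme \<Rightarrow> 'a set \<Rightarrow> 'a \<Rightarrow> nat" where
  "cox_length W S w = (LEAST n. \<exists>us \<in> lists S. length us = n \<and> word_prod W us = w)"

definition right_weak_order :: "('a, 'b) monoid_scheme \<Rightarrow> 'a set \<Rightarrow> 'a gorder" where
  "right_weak_order W S =
     \<lparr>carrier = carrier W,
      eq = (=),
      le = (\<lambda>u v. cox_length W S u + cox_length W S (inv\<^bsub>W\<^esub> u \<otimes>\<^bsub>W\<^esub> v) = cox_length W S v)\<rparr>"

definition left_descents :: "('a, 'b) monoid_scheme \<Rightarrow> 'a set \<Rightarrow> 'a \<Rightarrow> 'a set" where
  "left_descents W S w = {s \<in> S. cox_length W S (s \<otimes>\<^bsub>W\<^esub> w) < cox_length W S w}"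

definition min_coset_reps :: "('a, 'b) monoid_scheme \<Rightarrow> 'a set \<Rightarrow> 'a set \<Rightarrow> 'a set" where
  "min_coset_reps W S I =
     {w \<in> carrier W. \<forall>s\<in>I. cox_length W S (w \<otimes>\<^bsub>W\<^esub> s) > cox_length W S w}"

definition finite_type :: "('a, 'b) monoid_scheme \<Rightarrow> 'a set \<Rightarrow> 'a set set" where
  "finite_type W S = {I. I \<subseteq> S \<and> finite (generate W I)}"

text \<open>Only meaningful when \<open>generate W I\<close> is finite, where the longest element is unique.\<close>

definition longest_elem :: "('a, 'b) monoid_scheme \<Rightarrow> 'a set \<Rightarrow> 'a set \<Rightarrow> 'a" where
  "longest_elem W S I =
     (THE w. w \<in> generate W I \<and> (\<forall>v \<in> generate W I. cox_length W S v \<le> cox_length W S w))"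

definition davis_complex :: "('a, 'b) monoid_scheme \<Rightarrow> 'a set \<Rightarrow> 'a set set" where
  "davis_complex W S = (\<Union>I \<in> finite_type W S. lcosets\<^bsub>W\<^esub> (generate W I))"

text \<open>
  Elements of the Davis complex are cosets as sets, so the order quantifies over the
  presentations \<open>x W\<^sub>I\<close> with \<open>x \<in> W\<^sup>I\<close>. Each coset has exactly one such presentation.
\<close>

definition facial_weak_order :: "('a, 'b) monoid_scheme \<Rightarrow> 'a set \<Rightarrow> 'a set gorder" where
  "facial_weak_order W S =
     \<lparr>carrier = davis_complex W S,
      eq = (=),
      le = (\<lambda>A B. \<exists>I \<in> finite_type W S. \<exists>J \<in> finite_type W S.
              \<exists>x \<in> min_coset_reps W S I. \<exists>y \<in> min_coset_reps W S J.
                A = x <#\<^bsub>W\<^esub> generate W I \<and> B = y <#\<^bsub>W\<^esub> generate W J \<and>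
                x \<sqsubseteq>\<^bsub>right_weak_order W S\<^esub> y \<and>
                x \<otimes>\<^bsub>W\<^esub> longest_elem W S I \<sqsubseteq>\<^bsub>right_weak_order W S\<^esub> y \<otimes>\<^bsub>W\<^esub> longest_elem W S J)\<rparr>"

end

theory Submission
  imports Defs
begin

text \<open>
  The exchange condition, obtained from the parity with which a reflection occurs in a word, gives:
  if every element of \<open>I\<close> is a left descent of \<open>x\<close>, then \<open>W\<^sub>I\<close> is finite and lies below \<open>x\<close>. This
  yields meets in the right weak order. For the facial weak order, with \<open>z = x \<and> y\<close> and \<open>u W\<^sub>L\<close> a
  common lower bound, write \<open>z = u c\<close>. Each \<open>s \<in> L\<close> either lies below \<open>c\<close> or satisfies \<open>s c = c q\<close> with
  \<open>q \<in> K\<close>; in both cases \<open>s\<close> is a descent of \<open>c w\<^sub>K\<close>, so \<open>w\<^sub>L\<close> is below \<open>c w\<^sub>K\<close>.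
\<close>

text \<open>Let \<open>v\<close> be the meet of \<open>x w_I\<close> and \<open>y w_J\<close>. The
  set \<open>K\<close> is the largest one whose coset \<open>z W_K\<close> fits between
  \<open>z\<close> and \<open>v\<close>, which makes \<open>z W_K\<close> a common lower bound. The
  obstacle is maximality: \<open>z w_K\<close> may lie strictly below \<open>v\<close>, so the
  inequality \<open>u w_L \<le> v\<close>, immediate from meets in the weak order, does not yield
  \<open>u w_L \<le> z w_K\<close>. What helps is that \<open>w_L\<close> is the join of
  \<open>L\<close>, so after cancelling \<open>u\<close> only single letters have to be compared
  with \<open>c w_K\<close>. As \<open>W\<close> may be infinite, there is no longest element of
  \<open>W\<close> to exchange joins and meets; meets are built by induction on length, and
  finiteness of \<open>W_K\<close> has to be derived. All that is known about \<open>W\<close> is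
  its presentation, so lower bounds on lengths come from invariants of words that are tested on
  relators.\<close>

lemma sum_lessThan_add:
  fixes f :: "nat \<Rightarrow> 'a::comm_monoid_add"
  shows "(\<Sum>i<k + n. f i) = (\<Sum>i<k. f i) + (\<Sum>i<n. f (k + i))"
  by (induction n) (simp_all add: add.assoc)

lemma (in group) inv_mult_cancel_left [simp]:
  "x \<in> carrier G \<Longrightarrow> y \<in> carrier G \<Longrightarrow> inv x \<otimes> (x \<otimes> y) = y"
  "x \<in> carrier G \<Longrightarrow> y \<in> carrier G \<Longrightarrow> x \<otimes> (inv x \<otimes> y) = y"
  by (simp_all flip: m_assoc)

context coxeter_system
begin

section \<open>Words and the exchange condition\<close>

lemma gen_closed [simp]: "s \<in> S \<Longrightarrow> s \<in> carrier W"
  using S_subset by blast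

lemma word_prod_Nil [simp]: "word_prod W [] = \<one>"
  by (simp add: word_prod_def)

lemma word_prod_Cons [simp]: "word_prod W (s # us) = s \<otimes> word_prod W us"
  by (simp add: word_prod_def)

lemma word_prod_closed [simp]: "us \<in> lists S \<Longrightarrow> word_prod W us \<in> carrier W"
  by (induction us) auto

lemma word_prod_append:
  "us \<in> lists S \<Longrightarrow> vs \<in> lists S \<Longrightarrow> word_prod W (us @ vs) = word_prod W us \<otimes> word_prod W vs"
  by (induction us) (auto simp: m_assoc)

lemma word_prod_alternating:
  "s \<in> S \<Longrightarrow> t \<in> S \<Longrightarrow> word_prod W (concat (replicate k [s, t])) = (s \<otimes> t) [^] k"
proof (induction k)
  case (Suc k)
  then show ?case
    using nat_pow_Suc2[of "s \<otimes> t" k] by (simp add: m_assoc)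
qed simp

lemma alternating_in_lists [simp]:
  "s \<in> S \<Longrightarrow> t \<in> S \<Longrightarrow> concat (replicate k [s, t]) \<in> lists S"
  by (induction k) auto

text \<open>Equality of products is the congruence generated by the relators, so a function of words
  depends only on the product once inserting a relator leaves it unchanged. The matrix
  \<open>m\<close> stays hidden; a relator enters only through
  \<open>(s \<otimes> t) [^] k = \<one>\<close>.\<close>

lemma word_invariant:
  assumes inv: "\<And>us vs s t k. \<lbrakk>us \<in> lists S; vs \<in> lists S; s \<in> S; t \<in> S; (s \<otimes> t) [^] (k::nat) = \<one>\<rbrakk>
      \<Longrightarrow> f (us @ concat (replicate k [s, t]) @ vs) = f (us @ vs)"
    and "us \<in> lists S" "vs \<in> lists S" "word_prod W us = word_prod W vs"
  shows "f us = f vs"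
proof -
  obtain m where m: "coxeter_matrix S m"
    "\<And>us vs. us \<in> lists S \<Longrightarrow> vs \<in> lists S \<Longrightarrow>
      word_prod W us = word_prod W vs \<longleftrightarrow> coxeter_cong S m us vs"
    using presentation by blast
  have "coxeter_cong S m us vs"
    using m assms by blast
  then show ?thesis
  proof induction
    case (relator s t k us vs)
    \<comment> \<open>In the empty context the relator is congruent to the empty word, which the
      presentation turns into an equation in the group.\<close>
    have "coxeter_cong S m ([] @ concat (replicate k [s, t]) @ []) ([] @ [])"
      using relator by (intro coxeter_cong.relator) auto
    then have "word_prod W (concat (replicate k [s, t])) = word_prod W []"
      using m(2)[of "concat (replicate k [s, t])" "[]"] relator by simp
    then show ?case
      using relator by (intro inv) (simp_all add: word_prod_alternating)
  qed simp_all
qed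

lemma gen_square [simp]: "s \<in> S \<Longrightarrow> s \<otimes> s = \<one>"
proof -
  assume s: "s \<in> S"
  obtain m where m: "coxeter_matrix S m"
    "\<And>us vs. us \<in> lists S \<Longrightarrow> vs \<in> lists S \<Longrightarrow>
      word_prod W us = word_prod W vs \<longleftrightarrow> coxeter_cong S m us vs"
    using presentation by blast
  have "coxeter_cong S m ([] @ concat (replicate 1 [s, s]) @ []) ([] @ [])"
    using s m(1) by (intro coxeter_cong.relator) (auto simp: coxeter_matrix_def one_enat_def)
  then show ?thesis
    using m(2)[of "[s, s]" "[]"] s by simp
qed

lemma gen_inv [simp]: "s \<in> S \<Longrightarrow> inv s = s"
  by (simp add: inv_equality)

lemma gen_cancel [simp]: "s \<in> S \<Longrightarrow> x \<in> carrier W \<Longrightarrow> s \<otimes> (s \<otimes> x) = x"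
  by (simp flip: m_assoc)

lemma rev_in_lists [simp]: "rev us \<in> lists A \<longleftrightarrow> us \<in> lists A"
  by (simp add: lists_eq_set)

lemma word_prod_rev: "us \<in> lists S \<Longrightarrow> word_prod W (rev us) = inv (word_prod W us)"
  by (induction us) (simp_all add: word_prod_append inv_mult_group Cons_in_lists_iff)

lemma generate_eq_word_prods:
  assumes "I \<subseteq> S"
  shows "generate W I = word_prod W ` lists I"
proof
  have ls: "lists I \<subseteq> lists S"
    using assms by (rule lists_mono)
  show "generate W I \<subseteq> word_prod W ` lists I"
  proof
    fix w assume "w \<in> generate W I"
    then show "w \<in> word_prod W ` lists I"
    proof induction
      case one
      show ?case by (rule image_eqI[where x="[]"]) auto
    next
      case (incl h)
      then have "h = word_prod W [h]" "[h] \<in> lists I"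
        using assms by auto
      then show ?case by blast
    next
      case (inv h)
      then have "inv h = word_prod W [h]" "[h] \<in> lists I"
        using assms by (auto simp: subset_iff)
      then show ?case by blast
    next
      case (eng h1 h2)
      then obtain us vs where "us \<in> lists I" "vs \<in> lists I" "h1 = word_prod W us" "h2 = word_prod W vs"
        by auto
      then have "h1 \<otimes> h2 = word_prod W (us @ vs)" "us @ vs \<in> lists I"
        using ls by (auto simp: word_prod_append subset_iff)
      then show ?case by blast
    qed
  qed
  show "word_prod W ` lists I \<subseteq> generate W I"
  proof (rule image_subsetI)
    fix us assume "us \<in> lists I"
    then show "word_prod W us \<in> generate W I"
      by (induction us) (auto intro: generate.intros)
  qed
qed

section \<open>Length, parity and prefix reflections\<close>

abbreviation len :: "'a \<Rightarrow> nat" where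
  "len \<equiv> cox_length W S"

lemma reduced_word:
  assumes "w \<in> carrier W"
  obtains us where "us \<in> lists S" "word_prod W us = w" "length us = len w"
proof -
  obtain vs where "vs \<in> lists S" "word_prod W vs = w"
    using assms generate_eq_word_prods[of S] generates by auto
  then have "\<exists>n. \<exists>us \<in> lists S. length us = n \<and> word_prod W us = w"
    by blast
  from LeastI_ex[OF this] show ?thesis
    using that unfolding cox_length_def by blast
qed

lemma len_word_prod_le: "us \<in> lists S \<Longrightarrow> len (word_prod W us) \<le> length us"
  unfolding cox_length_def by (rule Least_le) auto

text \<open>Every relator has even length \<open>2 * k\<close>, so parity of word length is an
  invariant of the product. This is the sign character; it also shows that no generator is
  trivial.\<close>

lemma even_len_word_prod:
  assumes "us \<in> lists S"
  shows "even (len (word_prod W us)) \<longleftrightarrow> even (length us)"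
proof -
  have len_alt: "length (concat (replicate k [s, t])) = 2 * k" for k and s t :: 'a
    by (induction k) auto
  obtain vs where vs: "vs \<in> lists S" "word_prod W vs = word_prod W us"
    "length vs = len (word_prod W us)"
    using assms reduced_word[of "word_prod W us"] by auto
  have "even (length vs) = even (length us)"
    by (rule word_invariant[where f="\<lambda>us. even (length us)"])
      (use assms vs in \<open>simp_all only: length_append len_alt, simp_all\<close>)
  then show ?thesis
    using vs by simp
qed

lemma len_one [simp]: "len \<one> = 0"
  using len_word_prod_le[of "[]"] by simp

lemma len_zero_iff: "w \<in> carrier W \<Longrightarrow> len w = 0 \<longleftrightarrow> w = \<one>"
  by (metis len_one length_0_conv reduced_word word_prod_Nil)

lemma len_gen [simp]: "s \<in> S \<Longrightarrow> len s = 1"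
  using even_len_word_prod[of "[s]"] len_word_prod_le[of "[s]"]
  by (auto simp: le_Suc_eq)

lemma len_mult_le:
  assumes "u \<in> carrier W" "v \<in> carrier W"
  shows "len (u \<otimes> v) \<le> len u + len v"
proof -
  obtain us vs where "us \<in> lists S" "word_prod W us = u" "length us = len u"
    "vs \<in> lists S" "word_prod W vs = v" "length vs = len v"
    using assms by (metis reduced_word)
  then show ?thesis
    using len_word_prod_le[of "us @ vs"] by (simp add: word_prod_append)
qed

lemma even_len_mult:
  assumes "u \<in> carrier W" "v \<in> carrier W"
  shows "even (len (u \<otimes> v)) \<longleftrightarrow> even (len u + len v)"
proof -
  obtain us vs where "us \<in> lists S" "word_prod W us = u" "length us = len u"
    "vs \<in> lists S" "word_prod W vs = v" "length vs = len v"
    using assms by (metis reduced_word)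
  then show ?thesis
    using even_len_word_prod[of "us @ vs"] by (simp add: word_prod_append)
qed

lemma len_inv [simp]:
  assumes "u \<in> carrier W"
  shows "len (inv u) = len u"
proof -
  have le: "len (inv v) \<le> len v" if v: "v \<in> carrier W" for v
  proof -
    obtain vs where "vs \<in> lists S" "word_prod W vs = v" "length vs = len v"
      using v by (metis reduced_word)
    then show ?thesis
      using len_word_prod_le[of "rev vs"] by (simp add: word_prod_rev)
  qed
  show ?thesis
    using le[of u] le[of "inv u"] assms by simp
qed

text \<open>The triangle inequality bounds the change of length by one, and parity excludes no
  change.\<close>

lemma len_gen_mult:
  assumes "s \<in> S" "w \<in> carrier W"
  shows "len (s \<otimes> w) = Suc (len w) \<or> len w = Suc (len (s \<otimes> w))"
proof -
  have "len (s \<otimes> w) \<le> Suc (len w)" "len w \<le> Suc (len (s \<otimes> w))"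
    using len_mult_le[of s w] len_mult_le[of s "s \<otimes> w"] assms by simp_all
  moreover have "even (len (s \<otimes> w)) \<longleftrightarrow> odd (len w)"
    using even_len_mult[of s w] assms by simp
  ultimately show ?thesis
    by (cases "len (s \<otimes> w) = len w") auto
qed

lemma len_mult_gen:
  assumes "s \<in> S" "w \<in> carrier W"
  shows "len (w \<otimes> s) = Suc (len w) \<or> len w = Suc (len (w \<otimes> s))"
proof -
  have "len (w \<otimes> s) = len (s \<otimes> inv w)"
    using len_inv[of "w \<otimes> s"] assms by (simp add: inv_mult_group)
  then show ?thesis
    using len_gen_mult[of s "inv w"] assms by simp
qed

text \<open>
  The number of positions \<open>i\<close> at which the prefix reflection
  \<open>s\<^sub>1 \<dots> s\<^sub>i \<dots> s\<^sub>1\<close> of the word \<open>s\<^sub>1 \<dots> s\<^sub>n\<close> equals \<open>r\<close>. Its parity depends only on the group element.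
\<close>
primrec refl_count :: "'a list \<Rightarrow> 'a \<Rightarrow> nat" where
  "refl_count [] r = 0"
| "refl_count (s # us) r = of_bool (r = s) + refl_count us (s \<otimes> r \<otimes> s)"

lemma refl_count_append:
  "us \<in> lists S \<Longrightarrow> r \<in> carrier W \<Longrightarrow>
    refl_count (us @ vs) r =
      refl_count us r + refl_count vs (inv (word_prod W us) \<otimes> r \<otimes> word_prod W us)"
  by (induction us arbitrary: r) (auto simp: inv_mult_group m_assoc)

lemma gen_conj_eq_iff:
  "s \<in> S \<Longrightarrow> r \<in> carrier W \<Longrightarrow> q \<in> carrier W \<Longrightarrow> s \<otimes> r \<otimes> s = q \<longleftrightarrow> r = s \<otimes> q \<otimes> s"
  by (auto simp: m_assoc)

text \<open>The prefix reflections of \<open>s t s t ...\<close> are \<open>s\<close>,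
  \<open>s t s\<close>, \<open>s t s t s\<close> and so on, that is, \<open>(s t)^i s\<close>.
  Peeling off one pair \<open>s, t\<close> shifts the exponent by two.\<close>

lemma refl_count_alternating:
  assumes "s \<in> S" "t \<in> S" "r \<in> carrier W"
  shows "refl_count (concat (replicate k [s, t])) r = (\<Sum>i<2 * k. of_bool (r = (s \<otimes> t) [^] i \<otimes> s))"
  using assms(3)
proof (induction k arbitrary: r)
  case (Suc k)
  define a where "a = s \<otimes> t"
  have a: "a \<in> carrier W"
    using assms by (simp add: a_def)
  have shift: "t \<otimes> (s \<otimes> r \<otimes> s) \<otimes> t = a [^] i \<otimes> s \<longleftrightarrow> r = a [^] Suc (Suc i) \<otimes> s" for i
  proof -
    have "a [^] Suc (Suc i) \<otimes> s = a \<otimes> a [^] i \<otimes> a \<otimes> s"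
      using a nat_pow_Suc2[of a i] by simp
    also have "\<dots> = s \<otimes> (t \<otimes> (a [^] i \<otimes> s) \<otimes> t) \<otimes> s"
      using a assms by (simp add: a_def m_assoc del: nat_pow_Suc)
    finally show ?thesis
      using a assms Suc.prems by (simp add: gen_conj_eq_iff del: nat_pow_Suc)
  qed
  have "refl_count (concat (replicate (Suc k) [s, t])) r =
      of_bool (r = s) + (of_bool (s \<otimes> r \<otimes> s = t) + refl_count (concat (replicate k [s, t])) (t \<otimes> (s \<otimes> r \<otimes> s) \<otimes> t))"
    by simp
  also have "s \<otimes> r \<otimes> s = t \<longleftrightarrow> r = a [^] Suc 0 \<otimes> s"
    using assms Suc.prems a by (subst gen_conj_eq_iff) (simp_all add: a_def m_assoc)
  also have "r = s \<longleftrightarrow> r = a [^] (0::nat) \<otimes> s"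
    using assms by simp
  also have "refl_count (concat (replicate k [s, t])) (t \<otimes> (s \<otimes> r \<otimes> s) \<otimes> t) =
      (\<Sum>i<2 * k. of_bool (r = a [^] Suc (Suc i) \<otimes> s))"
    using assms Suc.prems by (subst Suc.IH) (simp_all only: shift flip: a_def, simp_all)
  finally show ?case
    unfolding a_def[symmetric] mult_Suc_right add_2_eq_Suc sum.lessThan_Suc_shift by simp
qed simp

text \<open>If \<open>(s t)^k = 1\<close>, the sum over \<open>2 * k\<close> exponents consists of
  two equal halves.\<close>

lemma even_refl_count_relator:
  assumes "s \<in> S" "t \<in> S" "r \<in> carrier W" "(s \<otimes> t) [^] k = \<one>"
  shows "even (refl_count (concat (replicate k [s, t])) r)"
proof -
  have "(s \<otimes> t) [^] (k + i) = (s \<otimes> t) [^] i" for i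
    using assms by (simp flip: nat_pow_mult)
  then show ?thesis
    using assms by (simp add: refl_count_alternating mult_2 sum_lessThan_add)
qed

text \<open>Deleting a relator removes an even count, and since its product is \<open>\<one>\<close>
  the suffix after it sees the same conjugate of \<open>r\<close>.\<close>

lemma odd_refl_count_cong:
  assumes "us \<in> lists S" "vs \<in> lists S" "word_prod W us = word_prod W vs" "r \<in> carrier W"
  shows "odd (refl_count us r) \<longleftrightarrow> odd (refl_count vs r)"
  by (rule word_invariant[where f="\<lambda>us. odd (refl_count us r)", OF _ assms(1-3)])
    (use assms(4) in \<open>simp add: refl_count_append word_prod_alternating even_refl_count_relator\<close>)

text \<open>A nonzero count says that \<open>r\<close> is the prefix reflection of some position,
  and left multiplication by that reflection deletes the letter there.\<close>

lemma refl_count_deletion: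
  assumes "us \<in> lists S" "r \<in> carrier W" "refl_count us r \<noteq> 0"
  shows "\<exists>xs y zs. us = xs @ y # zs \<and> r \<otimes> word_prod W us = word_prod W (xs @ zs)"
  using assms
proof (induction us arbitrary: r)
  case (Cons s us)
  then have s: "s \<in> S" and us: "us \<in> lists S"
    by auto
  show ?case
  proof (cases "r = s")
    case True
    then have "s # us = [] @ s # us \<and> r \<otimes> word_prod W (s # us) = word_prod W ([] @ us)"
      using s us by simp
    then show ?thesis by blast
  next
    case False
    then obtain xs y zs where *: "us = xs @ y # zs"
      "(s \<otimes> r \<otimes> s) \<otimes> word_prod W us = word_prod W (xs @ zs)"
      using Cons.IH[of "s \<otimes> r \<otimes> s"] Cons.prems s us by auto
    then have "r \<otimes> word_prod W (s # us) = word_prod W ((s # xs) @ zs)"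
      using s us Cons.prems(1) by (simp only: word_prod_Cons append_Cons flip: *(2)) (simp add: m_assoc)
    then show ?thesis
      using * by (intro exI[of _ "s # xs"]) auto
  qed
qed simp

text \<open>
  In a reduced word beginning with \<open>s\<close>, the reflection \<open>s\<close> is counted exactly once, so by parity it
  is counted in every word for the same element.
\<close>
lemma exchange:
  assumes "s \<in> S" "us \<in> lists S" "len (s \<otimes> word_prod W us) < len (word_prod W us)"
  shows "\<exists>xs y zs. us = xs @ y # zs \<and> s \<otimes> word_prod W us = word_prod W (xs @ zs)"
proof -
  define w where "w = word_prod W us"
  have w: "w \<in> carrier W"
    using assms by (simp add: w_def)
  obtain vs where vs: "vs \<in> lists S" "word_prod W vs = s \<otimes> w" "length vs = len (s \<otimes> w)"
    using assms w reduced_word[of "s \<otimes> w"] by auto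
  have len: "len w = Suc (len (s \<otimes> w))"
    using len_gen_mult[OF assms(1) w] assms(3) by (auto simp: w_def)
  have "refl_count vs s = 0"
  proof (rule ccontr)
    assume "refl_count vs s \<noteq> 0"
    then obtain xs y zs where *: "vs = xs @ y # zs" "s \<otimes> word_prod W vs = word_prod W (xs @ zs)"
      using refl_count_deletion[of vs s] vs assms by auto
    then have "w = word_prod W (xs @ zs)"
      using vs assms w by simp
    then have "len w \<le> length (xs @ zs)"
      using len_word_prod_le[of "xs @ zs"] vs * by simp
    then show False
      using * vs len by simp
  qed
  then have "odd (refl_count (s # vs) s)"
    using assms by simp
  moreover have "word_prod W (s # vs) = word_prod W us"
    using vs assms w by (simp add: w_def)
  ultimately have "odd (refl_count us s)"
    using odd_refl_count_cong[of "s # vs" us s] vs assms by simp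
  then have "refl_count us s \<noteq> 0"
    by (intro notI) simp
  then show ?thesis
    using refl_count_deletion[of us s] assms by simp
qed

text \<open>Exchange only deletes letters, so a word over \<open>I\<close> can be made reduced
  without leaving \<open>I\<close>. Hence length over \<open>I\<close> agrees with length over
  \<open>S\<close>.\<close>

lemma reduced_word_generate:
  assumes "I \<subseteq> S" "w \<in> generate W I"
  obtains us where "us \<in> lists I" "word_prod W us = w" "length us = len w"
proof -
  have "\<exists>vs \<in> lists I. word_prod W vs = word_prod W us \<and> length vs = len (word_prod W us)"
    if "us \<in> lists I" for us
    using that
  proof (induction us)
    case (Cons s us)
    then obtain vs where vs: "vs \<in> lists I" "word_prod W vs = word_prod W us"
      "length vs = len (word_prod W us)"
      by auto
    have s: "s \<in> I" "s \<in> S" and vsS: "vs \<in> lists S"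
      using Cons.hyps vs(1) assms(1) lists_mono[OF assms(1)] by auto
    consider "len (s \<otimes> word_prod W vs) = Suc (len (word_prod W vs))"
      | "len (word_prod W vs) = Suc (len (s \<otimes> word_prod W vs))"
      using len_gen_mult[of s "word_prod W vs"] s vsS by auto
    then show ?case
    proof cases
      case 1
      then show ?thesis
        using vs s by (intro bexI[of _ "s # vs"]) auto
    next
      case 2
      then obtain xs y zs where "vs = xs @ y # zs" "s \<otimes> word_prod W vs = word_prod W (xs @ zs)"
        using exchange[of s vs] s vsS by auto
      then show ?thesis
        using 2 vs s by (intro bexI[of _ "xs @ zs"]) auto
    qed
  qed auto
  then show ?thesis
    using assms that generate_eq_word_prods[of I] by auto
qed

lemma generate_closed: "I \<subseteq> S \<Longrightarrow> w \<in> generate W I \<Longrightarrow> w \<in> carrier W"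
  using generate_in_carrier S_subset by blast

text \<open>Exchange in the concatenation of reduced words for \<open>u\<close> and \<open>v\<close>
  deletes one letter. If it belongs to \<open>u\<close>, cancelling \<open>v\<close> shows that
  \<open>s u\<close> is short; if it belongs to \<open>v\<close>, a shorter word over
  \<open>I\<close> remains. Later uses exclude the first alternative by comparing lengths.\<close>

lemma exchange_mult:
  assumes "I \<subseteq> S" "s \<in> S" "u \<in> carrier W" "v \<in> generate W I"
    and less: "len (s \<otimes> u \<otimes> v) < len (u \<otimes> v)"
  shows "len (s \<otimes> u) < len u \<or> (\<exists>v' \<in> generate W I. len v' < len v \<and> s \<otimes> u \<otimes> v = u \<otimes> v')"
proof -
  obtain us where us: "us \<in> lists S" "word_prod W us = u" "length us = len u"
    using assms reduced_word by blast
  obtain vs where vs: "vs \<in> lists I" "word_prod W vs = v" "length vs = len v"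
    using assms reduced_word_generate by blast
  have vsS: "vs \<in> lists S"
    using vs lists_mono[OF assms(1)] by auto
  have v: "v \<in> carrier W"
    using assms generate_closed by blast
  have "len (s \<otimes> word_prod W (us @ vs)) < len (word_prod W (us @ vs))"
    using less us vs vsS assms v by (simp add: word_prod_append m_assoc)
  then obtain xs y zs where del: "us @ vs = xs @ y # zs"
    "s \<otimes> word_prod W (us @ vs) = word_prod W (xs @ zs)"
    using exchange[of s "us @ vs"] assms us vsS by auto
  have prod: "s \<otimes> u \<otimes> v = word_prod W (xs @ zs)"
    using us vs(2) vsS assms(2,3) v
    by (simp only: word_prod_append m_assoc gen_closed flip: del(2))
  from del(1) consider ds where "us = xs @ y # ds" "zs = ds @ vs"
    | ds where "xs = us @ ds" "vs = ds @ y # zs"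
    by (auto simp: append_eq_append_conv2 append_eq_Cons_conv)
  then show ?thesis
  proof cases
    case 1
    then have "s \<otimes> u \<otimes> v = word_prod W (xs @ ds) \<otimes> v"
      using prod us vs vsS v by (simp add: word_prod_append m_assoc)
    then have "s \<otimes> u = word_prod W (xs @ ds)"
      using 1 us assms v by simp
    then have "len (s \<otimes> u) \<le> length (xs @ ds)"
      using len_word_prod_le[of "xs @ ds"] 1 us by simp
    then show ?thesis
      using 1 us by simp
  next
    case 2
    then have I: "ds @ zs \<in> lists I" and S: "ds @ zs \<in> lists S"
      using vs vsS by auto
    have "s \<otimes> u \<otimes> v = u \<otimes> word_prod W (ds @ zs)"
      using prod 2 us S by (simp add: word_prod_append)
    moreover have "len (word_prod W (ds @ zs)) < len v"
      using len_word_prod_le[OF S] 2 vs by simp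
    moreover have "word_prod W (ds @ zs) \<in> generate W I"
      using I assms generate_eq_word_prods by blast
    ultimately show ?thesis by blast
  qed
qed

section \<open>The right weak order\<close>

definition weak_le :: "'a \<Rightarrow> 'a \<Rightarrow> bool" (infix "\<preceq>" 50) where
  "u \<preceq> v \<longleftrightarrow> len u + len (inv u \<otimes> v) = len v"

abbreviation D :: "'a \<Rightarrow> 'a set" where
  "D \<equiv> left_descents W S"

lemma weak_le_mult_iff:
  "u \<in> carrier W \<Longrightarrow> a \<in> carrier W \<Longrightarrow> u \<preceq> u \<otimes> a \<longleftrightarrow> len (u \<otimes> a) = len u + len a"
  by (auto simp: weak_le_def)

lemma weak_leE:
  assumes "u \<preceq> v" "u \<in> carrier W" "v \<in> carrier W"
  obtains a where "a \<in> carrier W" "v = u \<otimes> a" "len v = len u + len a"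
  using assms that[of "inv u \<otimes> v"] by (auto simp: weak_le_def)

lemma weak_le_refl: "u \<in> carrier W \<Longrightarrow> u \<preceq> u"
  by (simp add: weak_le_def)

lemma one_weak_le: "u \<in> carrier W \<Longrightarrow> \<one> \<preceq> u"
  by (simp add: weak_le_def)

lemma weak_le_antisym:
  assumes "u \<preceq> v" "v \<preceq> u" "u \<in> carrier W" "v \<in> carrier W"
  shows "u = v"
proof -
  obtain a where a: "a \<in> carrier W" "v = u \<otimes> a" "len v = len u + len a"
    using assms weak_leE by blast
  then have "len a = 0"
    using assms by (simp add: weak_le_def)
  then show ?thesis
    using a assms by (simp add: len_zero_iff)
qed

lemma weak_le_trans:
  assumes "u \<preceq> v" "v \<preceq> w" "u \<in> carrier W" "v \<in> carrier W" "w \<in> carrier W"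
  shows "u \<preceq> w"
proof -
  obtain a where a: "a \<in> carrier W" "v = u \<otimes> a" "len v = len u + len a"
    using assms weak_leE by blast
  obtain b where b: "b \<in> carrier W" "w = v \<otimes> b" "len w = len v + len b"
    using assms weak_leE by blast
  have "w = u \<otimes> (a \<otimes> b)"
    using a b assms by (simp add: m_assoc)
  moreover have "len (u \<otimes> (a \<otimes> b)) = len u + len (a \<otimes> b)"
    using len_mult_le[of u "a \<otimes> b"] len_mult_le[of a b] a b assms by (simp add: m_assoc)
  ultimately show ?thesis
    using a b assms by (simp add: weak_le_mult_iff)
qed

text \<open>When lengths add in \<open>u a\<close>, they add in every \<open>u d\<close> with
  \<open>d\<close> below \<open>a\<close>, since the total forces equality in both triangle
  inequalities. Together with \<open>weak_le_cancel_left\<close> this allows a common prefix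
  \<open>u\<close> to be removed and restored.\<close>

lemma weak_le_mult_left:
  assumes "u \<preceq> u \<otimes> a" "d \<preceq> a" "u \<in> carrier W" "a \<in> carrier W" "d \<in> carrier W"
  shows "u \<otimes> d \<preceq> u \<otimes> a" "len (u \<otimes> d) = len u + len d"
proof -
  obtain b where b: "b \<in> carrier W" "a = d \<otimes> b" "len a = len d + len b"
    using assms weak_leE by blast
  have eq: "u \<otimes> a = (u \<otimes> d) \<otimes> b"
    using b assms by (simp add: m_assoc)
  have "len (u \<otimes> a) = len u + len d + len b"
    using assms b by (simp add: weak_le_mult_iff)
  then have "len (u \<otimes> d) = len u + len d \<and> len (u \<otimes> d \<otimes> b) = len (u \<otimes> d) + len b"
    using len_mult_le[of "u \<otimes> d" b] len_mult_le[of u d] b assms unfolding eq by simp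
  then show "u \<otimes> d \<preceq> u \<otimes> a" "len (u \<otimes> d) = len u + len d"
    unfolding eq using b assms by (simp_all add: weak_le_mult_iff)
qed

lemma weak_le_cancel_left:
  assumes "u \<preceq> u \<otimes> d" "u \<otimes> d \<preceq> u \<otimes> a" "u \<in> carrier W" "a \<in> carrier W" "d \<in> carrier W"
  shows "d \<preceq> a"
proof -
  obtain b where b: "b \<in> carrier W" "u \<otimes> a = u \<otimes> d \<otimes> b" "len (u \<otimes> a) = len (u \<otimes> d) + len b"
    using assms weak_leE[of "u \<otimes> d" "u \<otimes> a"] by auto
  have a: "a = d \<otimes> b"
    using b assms by (simp add: m_assoc)
  have "len (u \<otimes> a) = len u + len d + len b"
    using assms b by (simp add: weak_le_mult_iff)
  then have "len (d \<otimes> b) = len d + len b"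
    using len_mult_le[of u a] len_mult_le[of d b] b assms a by simp
  then show ?thesis
    using a b assms by (simp add: weak_le_mult_iff)
qed

section \<open>Left descents, finite parabolic subgroups and weak meets\<close>

lemma descent_iff_less: "s \<in> D w \<longleftrightarrow> s \<in> S \<and> len (s \<otimes> w) < len w"
  by (simp add: left_descents_def)

lemma descent_iff: "w \<in> carrier W \<Longrightarrow> s \<in> D w \<longleftrightarrow> s \<in> S \<and> s \<preceq> w"
  using len_gen_mult[of s w] by (auto simp: descent_iff_less weak_le_def)

lemma descents_subset: "D w \<subseteq> S"
  by (auto simp: left_descents_def)

lemma descent_mono:
  "s \<in> D u \<Longrightarrow> u \<preceq> v \<Longrightarrow> u \<in> carrier W \<Longrightarrow> v \<in> carrier W \<Longrightarrow> s \<in> D v"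
  using weak_le_trans[of s u v] by (auto simp: descent_iff)

lemma descent_exists:
  assumes "w \<in> carrier W" "w \<noteq> \<one>"
  obtains s where "s \<in> D w"
proof -
  obtain us where us: "us \<in> lists S" "word_prod W us = w" "length us = len w"
    using assms reduced_word by blast
  with assms obtain s vs where "us = s # vs"
    by (cases us) auto
  then have vs: "vs \<in> lists S" "s \<in> S" "w = s \<otimes> word_prod W vs" "len w = Suc (length vs)"
    using us by simp_all
  then have "s \<in> D w"
    using len_word_prod_le[of vs] by (simp add: descent_iff_less)
  then show ?thesis by (rule that)
qed

text \<open>Induction along a reduced word \<open>s p\<close>, with \<open>x = p v\<close> already
  known: \<open>s\<close> shortens \<open>x\<close> but lengthens \<open>p\<close>, so exchange
  deletes a letter of \<open>v\<close> and gives \<open>x = s p v'\<close> with lengths adding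
  up.\<close>

lemma generate_weak_le:
  assumes "x \<in> carrier W" "I \<subseteq> D x" "w \<in> generate W I"
  shows "w \<preceq> x"
proof -
  have I: "I \<subseteq> S"
    using assms descents_subset by blast
  have "word_prod W us \<preceq> x" if "us \<in> lists I" "length us = len (word_prod W us)" for us
    using that
  proof (induction us)
    case Nil
    then show ?case using assms by (simp add: one_weak_le)
  next
    case (Cons s us)
    define p where "p = word_prod W us"
    have s: "s \<in> D x" "s \<in> S" and us: "us \<in> lists S"
      using Cons.hyps assms I lists_mono[OF I] by auto
    then have p: "p \<in> carrier W"
      by (simp add: p_def)
    have sp: "len (s \<otimes> p) = Suc (len p)" "length us = len p"
      using Cons.prems len_word_prod_le[OF us] len_mult_le[OF _ p, of s] s by (simp_all add: p_def)
    then have "p \<preceq> x"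
      using Cons.IH p_def by simp
    then obtain v where v: "v \<in> carrier W" "x = p \<otimes> v" "len x = len p + len v"
      using p assms weak_leE by blast
    have "len (s \<otimes> p \<otimes> v) < len (p \<otimes> v)"
      using s v p by (simp add: descent_iff_less m_assoc)
    then obtain v' where v': "v' \<in> carrier W" "len v' < len v" "s \<otimes> p \<otimes> v = p \<otimes> v'"
      using exchange_mult[of S s p v] s p v sp generates by auto
    have x: "x = s \<otimes> p \<otimes> v'"
      using v' v s p by (metis gen_cancel gen_closed m_assoc m_closed)
    have "len x = len (s \<otimes> p) + len v'"
      using len_mult_le[of "s \<otimes> p" v'] v' v sp s p x by simp
    then show ?case
      using s p v' x by (simp add: p_def[symmetric] weak_le_mult_iff)
  qed
  then show ?thesis
    using assms I reduced_word_generate[of I w] by metis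
qed

text \<open>In one fixed word for \<open>x\<close>, a descent is determined by the position that
  exchange deletes, so there are no more descents than positions.\<close>

lemma finite_descents:
  assumes "x \<in> carrier W"
  shows "finite (D x)"
proof -
  obtain us where us: "us \<in> lists S" "word_prod W us = x"
    using assms reduced_word by blast
  have "D x \<subseteq> (\<lambda>i. word_prod W (take i us @ drop (Suc i) us) \<otimes> inv x) ` {..<length us}"
  proof
    fix s assume s: "s \<in> D x"
    then obtain xs y zs where *: "us = xs @ y # zs" "s \<otimes> x = word_prod W (xs @ zs)"
      using exchange[of s us] us by (auto simp: descent_iff_less)
    then have "s = word_prod W (take (length xs) us @ drop (Suc (length xs)) us) \<otimes> inv x"
      using s assms by (auto simp: descent_iff_less m_assoc simp flip: *(2))
    then show "s \<in> (\<lambda>i. word_prod W (take i us @ drop (Suc i) us) \<otimes> inv x) ` {..<length us}"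
      using *(1) by (intro image_eqI[where x="length xs"]) auto
  qed
  then show ?thesis
    by (rule finite_subset) simp
qed

text \<open>All of \<open>W_I\<close> lies below \<open>x\<close>, so its elements have words of
  length at most \<open>len x\<close> over the finite alphabet \<open>I\<close>.\<close>

lemma finite_type_descents:
  assumes "x \<in> carrier W" "I \<subseteq> D x"
  shows "I \<in> finite_type W S"
proof -
  have I: "I \<subseteq> S" "finite I"
    using assms descents_subset finite_descents finite_subset by blast+
  have "generate W I \<subseteq> word_prod W ` {us. set us \<subseteq> I \<and> length us \<le> len x}"
  proof
    fix w assume w: "w \<in> generate W I"
    then obtain us where us: "us \<in> lists I" "word_prod W us = w" "length us = len w"
      using I reduced_word_generate by blast
    moreover have "len w \<le> len x"
      using generate_weak_le[OF assms w] by (simp add: weak_le_def)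
    ultimately show "w \<in> word_prod W ` {us. set us \<subseteq> I \<and> length us \<le> len x}"
      by (intro image_eqI[where x=us]) (auto simp: lists_eq_set)
  qed
  then have "finite (generate W I)"
    by (rule finite_subset) (intro finite_imageI finite_lists_length_le I)
  then show ?thesis
    using I by (simp add: finite_type_def)
qed

lemma generate_subgroup: "I \<subseteq> S \<Longrightarrow> subgroup (generate W I) W"
  using generate_is_subgroup S_subset by blast

lemma gen_in_generate_iff:
  assumes "I \<subseteq> S" "s \<in> S"
  shows "s \<in> generate W I \<longleftrightarrow> s \<in> I"
proof
  assume "s \<in> generate W I"
  then obtain us where us: "us \<in> lists I" "word_prod W us = s" "length us = len s"
    using assms reduced_word_generate by blast
  then obtain t where "us = [t]"
    using assms by (auto simp: length_Suc_conv)
  then show "s \<in> I"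
    using us assms by auto
qed (rule generate.incl)

text \<open>An element \<open>u\<close> of maximal length in the finite group \<open>W_I\<close> has
  all of \<open>I\<close> as descents, so \<open>W_I\<close> lies below it. Another element of
  maximal length lies below \<open>u\<close> and hence equals \<open>u\<close>, which justifies the
  definite description.\<close>

lemma longest_elem:
  assumes "I \<in> finite_type W S"
  shows longest_elem_in: "longest_elem W S I \<in> generate W I"
    and weak_le_longest_elem: "\<And>w. w \<in> generate W I \<Longrightarrow> w \<preceq> longest_elem W S I"
proof -
  have I: "I \<subseteq> S" and fin: "finite (generate W I)"
    using assms by (auto simp: finite_type_def)
  let ?P = "\<lambda>w. w \<in> generate W I \<and> (\<forall>v \<in> generate W I. len v \<le> len w)"
  have "Max (len ` generate W I) \<in> len ` generate W I"
    using fin generate.one[of W I] by (intro Max_in) auto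
  then obtain u where u: "u \<in> generate W I" "len u = Max (len ` generate W I)"
    by auto
  then have Pu: "?P u"
    using fin by simp
  have uW: "u \<in> carrier W"
    using u I generate_closed by blast
  have "I \<subseteq> D u"
  proof
    fix s assume s: "s \<in> I"
    then have "len (s \<otimes> u) \<le> len u"
      using Pu by (auto intro: generate.intros)
    then show "s \<in> D u"
      using s I uW len_gen_mult[of s u] by (auto simp: descent_iff_less)
  qed
  then have le: "w \<preceq> u" if "w \<in> generate W I" for w
    using generate_weak_le uW that by blast
  have "longest_elem W S I = u"
    unfolding longest_elem_def
  proof (rule the_equality)
    fix w assume w: "?P w"
    have wW: "w \<in> carrier W"
      using w I generate_closed by blast
    have "w \<preceq> u"
      using w le by blast
    then obtain a where a: "a \<in> carrier W" "u = w \<otimes> a" "len u = len w + len a"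
      using wW uW weak_leE by blast
    moreover have "len u \<le> len w"
      using u w by blast
    ultimately show "w = u"
      using wW by (simp add: len_zero_iff)
  qed (rule Pu)
  then show "longest_elem W S I \<in> generate W I"
    "\<And>w. w \<in> generate W I \<Longrightarrow> w \<preceq> longest_elem W S I"
    using u le by auto
qed

lemma longest_elem_closed: "I \<in> finite_type W S \<Longrightarrow> longest_elem W S I \<in> carrier W"
  using longest_elem_in generate_closed by (auto simp: finite_type_def)

text \<open>Makes \<open>I\<close> recoverable from its longest element, as antisymmetry of the
  facial order requires.\<close>

lemma descents_longest_elem:
  assumes "I \<in> finite_type W S"
  shows "D (longest_elem W S I) = I"
proof -
  let ?w = "longest_elem W S I"
  have I: "I \<subseteq> S" and w: "?w \<in> generate W I" "?w \<in> carrier W"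
    using assms longest_elem_in longest_elem_closed by (auto simp: finite_type_def)
  show ?thesis
  proof
    show "I \<subseteq> D ?w"
      using weak_le_longest_elem[OF assms] I w generate.incl[of _ I W]
      by (auto simp only: descent_iff)
    show "D ?w \<subseteq> I"
    proof
      fix s assume "s \<in> D ?w"
      \<comment> \<open>With \<open>\<one>\<close> as left factor in \<open>exchange_mult\<close>,
        the deletion must happen inside \<open>W_I\<close>, because \<open>s\<close> cannot shorten
        \<open>\<one>\<close>.\<close>
      then have s: "s \<in> S" "len (s \<otimes> \<one> \<otimes> ?w) < len (\<one> \<otimes> ?w)"
        using w by (auto simp: descent_iff_less)
      then obtain w' where "w' \<in> generate W I" "s \<otimes> ?w = w'"
        using exchange_mult[of I s \<one> ?w] I w by (auto simp: generate_closed[OF I])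
      then have "s = w' \<otimes> inv ?w" "w' \<otimes> inv ?w \<in> generate W I"
        using s w I generate_subgroup[OF I] by (auto simp: m_assoc subgroup.m_closed subgroup.m_inv_closed)
      then show "s \<in> I"
        using gen_in_generate_iff I s by simp
    qed
  qed
qed

text \<open>
  If \<open>s\<close> and \<open>t\<close> are both descents of \<open>x\<close> and \<open>y\<close>, then the longest element of \<open>\<langle>s, t\<rangle>\<close> is a common
  lower bound. Hence the greatest common lower bounds starting with \<open>s\<close> and with \<open>t\<close> coincide.
\<close>
lemma weak_meet_exists:
  assumes "x \<in> carrier W" "y \<in> carrier W"
  shows "\<exists>m \<in> carrier W. m \<preceq> x \<and> m \<preceq> y \<and> (\<forall>u \<in> carrier W. u \<preceq> x \<longrightarrow> u \<preceq> y \<longrightarrow> u \<preceq> m)"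
  using assms
proof (induction "len x" arbitrary: x y rule: less_induct)
  case less
  note xy = less.prems
  \<comment> \<open>Since \<open>s x\<close> is shorter than \<open>x\<close>, induction gives the
    meet of \<open>s x\<close> and \<open>s y\<close>; multiplied by \<open>s\<close> it is greatest
    among the common lower bounds that start with \<open>s\<close>.\<close>
  have start: "\<exists>m \<in> carrier W. m \<preceq> x \<and> m \<preceq> y \<and> (\<forall>u \<in> carrier W. s \<in> D u \<longrightarrow> u \<preceq> x \<longrightarrow> u \<preceq> y \<longrightarrow> u \<preceq> m)"
    if s: "s \<in> D x" "s \<in> D y" for s
  proof -
    have sS: "s \<in> S" and le: "s \<preceq> s \<otimes> (s \<otimes> x)" "s \<preceq> s \<otimes> (s \<otimes> y)"
      using s xy by (auto simp: descent_iff)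
    obtain m where m: "m \<in> carrier W" "m \<preceq> s \<otimes> x" "m \<preceq> s \<otimes> y"
      "\<And>u. u \<in> carrier W \<Longrightarrow> u \<preceq> s \<otimes> x \<Longrightarrow> u \<preceq> s \<otimes> y \<Longrightarrow> u \<preceq> m"
      using less.hyps[of "s \<otimes> x" "s \<otimes> y"] s xy by (auto simp: descent_iff_less)
    have sm: "s \<otimes> m \<preceq> x" "s \<otimes> m \<preceq> y" "s \<preceq> s \<otimes> m"
      using weak_le_mult_left[OF le(1) m(2)] weak_le_mult_left[OF le(2) m(3)] m sS xy
      by (auto simp: weak_le_mult_iff)
    moreover have "u \<preceq> s \<otimes> m" if u: "u \<in> carrier W" "s \<in> D u" "u \<preceq> x" "u \<preceq> y" for u
    proof -
      have su: "s \<preceq> s \<otimes> (s \<otimes> u)"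
        using u sS by (simp add: descent_iff)
      have "s \<otimes> u \<preceq> s \<otimes> x" "s \<otimes> u \<preceq> s \<otimes> y"
        using weak_le_cancel_left[OF su, of "s \<otimes> x"] weak_le_cancel_left[OF su, of "s \<otimes> y"] u sS xy
        by auto
      then have "s \<otimes> u \<preceq> m"
        using m(4) u sS by simp
      then show ?thesis
        using weak_le_mult_left(1)[OF sm(3), of "s \<otimes> u"] u sS m by simp
    qed
    ultimately show ?thesis
      using m sS by (intro bexI[of _ "s \<otimes> m"]) auto
  qed
  show ?case
  proof (cases "D x \<inter> D y = {}")
    case True
    \<comment> \<open>A nontrivial common lower bound would contribute a common descent.\<close>
    have "u \<preceq> \<one>" if u: "u \<in> carrier W" "u \<preceq> x" "u \<preceq> y" for u
    proof -
      have "D u \<subseteq> D x \<inter> D y"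
        using descent_mono[of _ u x] descent_mono[of _ u y] u xy by blast
      then have "u = \<one>"
        using True u descent_exists[of u] by blast
      then show ?thesis by (simp add: weak_le_refl)
    qed
    then show ?thesis
      using xy one_weak_le by blast
  next
    case False
    then obtain s where s: "s \<in> D x" "s \<in> D y" by blast
    obtain m where m: "m \<in> carrier W" "m \<preceq> x" "m \<preceq> y"
      "\<And>u. u \<in> carrier W \<Longrightarrow> s \<in> D u \<Longrightarrow> u \<preceq> x \<Longrightarrow> u \<preceq> y \<Longrightarrow> u \<preceq> m"
      using start[OF s] by blast
    have "u \<preceq> m" if u: "u \<in> carrier W" "u \<preceq> x" "u \<preceq> y" for u
    proof (cases "u = \<one>")
      case True
      then show ?thesis using m one_weak_le by simp
    next
      case False
      then obtain t where t: "t \<in> D u"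
        using descent_exists u by blast
      then have t': "t \<in> D x" "t \<in> D y"
        using descent_mono u xy by blast+
      obtain n where n: "n \<in> carrier W" "n \<preceq> x" "n \<preceq> y"
        "\<And>u. u \<in> carrier W \<Longrightarrow> t \<in> D u \<Longrightarrow> u \<preceq> x \<Longrightarrow> u \<preceq> y \<Longrightarrow> u \<preceq> n"
        using start[OF t'] by blast
      have st: "{s, t} \<subseteq> D x" "{s, t} \<subseteq> D y"
        using s t' by auto
      have ft: "{s, t} \<in> finite_type W S"
        using finite_type_descents xy st by blast
      define w where "w = longest_elem W S {s, t}"
      have w: "w \<in> carrier W" "w \<in> generate W {s, t}" "D w = {s, t}"
        using ft by (auto simp: w_def longest_elem_closed longest_elem_in descents_longest_elem)
      have "w \<preceq> x" "w \<preceq> y"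
        using generate_weak_le st xy w by blast+
      then have "w \<preceq> n"
        using n w by blast
      then have "s \<in> D n"
        using descent_mono[of s w n] w n by blast
      then have "n \<preceq> m"
        using m n by blast
      moreover have "u \<preceq> n"
        using n u t by blast
      ultimately show ?thesis
        using weak_le_trans u n m by blast
    qed
    then show ?thesis
      using m by blast
  qed
qed

section \<open>Minimal coset representatives\<close>

text \<open>If the last letter of a reduced word \<open>p s\<close> over \<open>I\<close> shortened
  \<open>x p\<close>, exchange would delete a letter of \<open>x\<close>, and
  \<open>x p s p^-1\<close> would be an element of \<open>x W_I\<close> shorter than
  \<open>x\<close>.\<close>

lemma len_mult_of_minimal:
  assumes I: "I \<subseteq> S" and x: "x \<in> carrier W"
    and minimal: "\<And>w. w \<in> generate W I \<Longrightarrow> len x \<le> len (x \<otimes> w)"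
    and w: "w \<in> generate W I"
  shows "len (x \<otimes> w) = len x + len w"
proof -
  have "len (x \<otimes> word_prod W us) = len x + length us"
    if "us \<in> lists I" "length us = len (word_prod W us)" for us
    using that
  proof (induction us rule: rev_induct)
    case Nil
    then show ?case using x by simp
  next
    case (snoc s us)
    define p where "p = word_prod W us"
    have us: "us \<in> lists I" "us \<in> lists S" and s: "s \<in> I" "s \<in> S"
      using snoc.prems I lists_mono[OF I] by auto
    have p: "p \<in> carrier W" "p \<in> generate W I"
      using us I generate_eq_word_prods[OF I] by (auto simp: p_def simp del: in_lists_conv_set)
    have ps: "word_prod W (us @ [s]) = p \<otimes> s"
      using us s by (simp add: word_prod_append p_def)
    have len: "len (p \<otimes> s) = Suc (len p)" "length us = len p"
      using snoc.prems len_word_prod_le[OF us(2)] len_mult_gen[OF s(2) p(1)]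
      by (auto simp: ps simp flip: p_def)
    then have IH: "len (x \<otimes> p) = len x + len p"
      using snoc.IH us by (simp add: p_def)
    have "len (x \<otimes> p \<otimes> s) = Suc (len (x \<otimes> p))"
    proof (rule ccontr)
      assume "\<not> ?thesis"
      then have "len (x \<otimes> p \<otimes> s) < len (x \<otimes> p)"
        using len_mult_gen[of s "x \<otimes> p"] s p x by auto
      \<comment> \<open>Exchange acts on the left, hence the passage to inverses. As
        \<open>s\<close> lengthens \<open>inv p\<close>, the deletion falls into
        \<open>inv x\<close>.\<close>
      then have "len (s \<otimes> inv p \<otimes> inv x) < len (inv p \<otimes> inv x)"
        using len_inv[of "x \<otimes> p \<otimes> s"] len_inv[of "x \<otimes> p"] s p x
        by (simp add: inv_mult_group m_assoc)
      moreover have "len (s \<otimes> inv p) = Suc (len (inv p))"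
        using len len_inv[of "p \<otimes> s"] s p by (simp add: inv_mult_group)
      ultimately obtain v where v: "v \<in> carrier W" "len v < len (inv x)"
        "s \<otimes> inv p \<otimes> inv x = inv p \<otimes> v"
        using exchange_mult[of S s "inv p" "inv x"] s p x generates by auto
      have "p \<otimes> (s \<otimes> inv p \<otimes> inv x) = v"
        using v p by simp
      then have "inv v = x \<otimes> (p \<otimes> s \<otimes> inv p)"
        using s p x by (auto simp: inv_mult_group m_assoc)
      moreover have "p \<otimes> s \<otimes> inv p \<in> generate W I"
        using p s generate_m_inv_closed[of I p] I S_subset by (auto intro: generate.intros)
      ultimately show False
        using minimal[of "p \<otimes> s \<otimes> inv p"] v x len_inv[of v] by simp
    qed
    then show ?case
      using IH len s p x by (simp add: ps m_assoc)
  qed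
  then show ?thesis
    using w I reduced_word_generate[of I w] by metis
qed

lemma min_coset_rep_closed: "x \<in> min_coset_reps W S I \<Longrightarrow> x \<in> carrier W"
  by (simp add: min_coset_reps_def)

text \<open>The definition of \<open>min_coset_reps\<close> tests single letters only. To reach all
  of \<open>W_I\<close>, take a shortest element \<open>x v\<close> of the coset, from which lengths
  add: for nontrivial \<open>v\<close>, the last letter \<open>s\<close> of a reduced word for
  \<open>inv v\<close> would satisfy \<open>len (x \<otimes> s) < len x\<close>.\<close>

lemma len_min_coset_rep_mult:
  assumes I: "I \<subseteq> S" and x: "x \<in> min_coset_reps W S I" and w: "w \<in> generate W I"
  shows "len (x \<otimes> w) = len x + len w"
proof -
  have xW: "x \<in> carrier W"
    using x by (rule min_coset_rep_closed)
  obtain v where v: "v \<in> generate W I"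
    "\<And>w. w \<in> generate W I \<Longrightarrow> len (x \<otimes> v) \<le> len (x \<otimes> w)"
    using ex_has_least_nat[of "\<lambda>w. w \<in> generate W I" \<one> "\<lambda>w. len (x \<otimes> w)"] generate.one by blast
  have vW: "v \<in> carrier W" and vi: "inv v \<in> generate W I"
    using v I generate_closed generate_m_inv_closed[of I v] S_subset by blast+
  have min: "len (x \<otimes> v) \<le> len (x \<otimes> v \<otimes> w)" if "w \<in> generate W I" for w
    using v(2)[of "v \<otimes> w"] v(1) that xW vW generate_closed[OF I that]
    by (simp add: m_assoc generate.eng)
  obtain us where us: "us \<in> lists I" "word_prod W us = inv v" "length us = len (inv v)"
    using vi I reduced_word_generate by blast
  have "us = []"
  proof (cases us rule: rev_cases)
    case (snoc vs s)
    define p where "p = word_prod W vs"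
    have vs: "vs \<in> lists I" "vs \<in> lists S" and s: "s \<in> I" "s \<in> S"
      using us snoc I lists_mono[OF I] by auto
    have p: "p \<in> carrier W" "p \<in> generate W I"
      using vs generate_eq_word_prods[OF I] by (auto simp: p_def simp del: in_lists_conv_set)
    have "inv v = p \<otimes> s"
      using us(2) snoc vs s by (simp add: word_prod_append p_def)
    then have "inv v \<otimes> s = p"
      using p s by (simp add: m_assoc)
    then have "x \<otimes> s = x \<otimes> v \<otimes> p"
      using xW vW s by (simp add: m_assoc flip: \<open>inv v \<otimes> s = p\<close>)
    moreover have "x = x \<otimes> v \<otimes> inv v"
      using xW vW by (simp add: m_assoc)
    moreover have "len p < len (inv v)"
      using len_word_prod_le[OF vs(2)] us(3) snoc by (simp add: p_def)
    ultimately have "len (x \<otimes> s) < len x"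
      using len_mult_of_minimal[OF I _ min p(2)] len_mult_of_minimal[OF I _ min vi] xW vW
      by (metis add_less_cancel_left m_closed)
    moreover have "len x < len (x \<otimes> s)"
      using x s by (simp add: min_coset_reps_def)
    ultimately show ?thesis by simp
  qed
  then have "v = \<one>"
    using us vW by (metis inv_inv inv_one word_prod_Nil)
  then show ?thesis
    using len_mult_of_minimal[OF I xW _ w] v xW by simp
qed

lemma weak_le_min_coset_rep_mult:
  assumes "I \<subseteq> S" "x \<in> min_coset_reps W S I" "w \<in> generate W I" "v \<in> generate W I" "w \<preceq> v"
  shows "x \<otimes> w \<preceq> x \<otimes> v"
  using assms weak_le_mult_left(1)[of x v w] len_min_coset_rep_mult[of I x v]
  by (simp add: weak_le_mult_iff min_coset_rep_closed generate_closed[OF assms(1)])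

lemma min_coset_rep_suffix:
  assumes "u \<preceq> u \<otimes> a" "u \<otimes> a \<in> min_coset_reps W S I" "I \<subseteq> S" "u \<in> carrier W" "a \<in> carrier W"
  shows "a \<in> min_coset_reps W S I"
  unfolding min_coset_reps_def
proof (intro CollectI conjI ballI)
  fix s assume s: "s \<in> I"
  then have sS: "s \<in> S"
    using assms by blast
  have "len u + len a < len (u \<otimes> (a \<otimes> s))"
    using assms s sS by (simp add: min_coset_reps_def weak_le_mult_iff flip: m_assoc)
  then show "len a < len (a \<otimes> s)"
    using len_mult_le[of u "a \<otimes> s"] assms sS by simp
qed (fact assms)

text \<open>The coset determines its subgroup, which determines its generators in \<open>S\<close>.
  With \<open>y = x w\<close>, lengths add both in \<open>x w\<close> and in
  \<open>y (inv w)\<close>, so \<open>w\<close> has length zero.\<close>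

lemma min_coset_rep_unique:
  assumes "I \<subseteq> S" "J \<subseteq> S" "x \<in> min_coset_reps W S I" "y \<in> min_coset_reps W S J"
    and eq: "x <# generate W I = y <# generate W J"
  shows "x = y \<and> I = J"
proof -
  have xW: "x \<in> carrier W" and yW: "y \<in> carrier W"
    using assms min_coset_rep_closed by blast+
  have sub: "subgroup (generate W I) W" "subgroup (generate W J) W"
    using assms generate_subgroup by blast+
  have "y \<in> x <# generate W I"
    using lcos_self[OF yW sub(2)] eq by simp
  then obtain w where w: "w \<in> generate W I" "y = x \<otimes> w"
    by (auto simp: l_coset_def)
  have wW: "w \<in> carrier W"
    using w assms generate_closed by blast
  have cancel: "inv y <# (y <# H) = H" if "subgroup H W" for H
    using lcos_m_assoc[of H "inv y" y] subgroup.subset[OF that] yW by (simp add: lcos_mult_one)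
  have "y <# generate W I = y <# generate W J"
    using l_repr_independence[OF _ xW sub(1)] \<open>y \<in> x <# generate W I\<close> eq by simp
  then have gen: "generate W I = generate W J"
    using cancel sub by metis
  then have "I = J"
    using gen_in_generate_iff[of I] gen_in_generate_iff[of J] assms by blast
  moreover have "len y = len x + len w"
    using len_min_coset_rep_mult[of I x w] w assms by simp
  moreover have "len x = len y + len (inv w)"
  proof -
    have "inv w \<in> generate W J"
      using w gen subgroup.m_inv_closed[OF sub(1)] by blast
    then have "len (y \<otimes> inv w) = len y + len (inv w)"
      using len_min_coset_rep_mult[of J y "inv w"] assms by blast
    then show ?thesis
      using w wW xW by (simp add: m_assoc)
  qed
  ultimately show ?thesis
    using w wW xW by (simp add: len_zero_iff)
qed

lemma davis_complex_min_rep: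
  assumes "A \<in> davis_complex W S"
  obtains I x where "I \<in> finite_type W S" "x \<in> min_coset_reps W S I" "A = x <# generate W I"
proof -
  obtain I g where I: "I \<in> finite_type W S" and g: "g \<in> carrier W" "A = g <# generate W I"
    using assms by (auto simp: davis_complex_def LCOSETS_def)
  have IS: "I \<subseteq> S"
    using I by (simp add: finite_type_def)
  have sub: "subgroup (generate W I) W"
    using IS by (rule generate_subgroup)
  obtain x where x: "x \<in> A" "\<And>y. y \<in> A \<Longrightarrow> len x \<le> len y"
    using ex_has_least_nat[of "\<lambda>x. x \<in> A" g len] lcos_self[OF g(1) sub] g(2) by blast
  have xW: "x \<in> carrier W"
    using x g sub l_coset_carrier by blast
  have A: "A = x <# generate W I"
    using l_repr_independence[OF _ g(1) sub] x g by simp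
  have "len x < len (x \<otimes> s)" if s: "s \<in> I" for s
  proof -
    have "x \<otimes> s \<in> A"
      using s unfolding A by (auto simp: l_coset_def intro: generate.incl)
    then show ?thesis
      using x(2)[of "x \<otimes> s"] len_mult_gen[of s x] s IS xW by auto
  qed
  then show ?thesis
    using that[OF I _ A] xW by (simp add: min_coset_reps_def)
qed

lemma coset_in_davis_complex:
  "I \<in> finite_type W S \<Longrightarrow> x \<in> carrier W \<Longrightarrow> x <# generate W I \<in> davis_complex W S"
  by (auto simp: davis_complex_def LCOSETS_def)

section \<open>Meets in the facial weak order\<close>

text \<open>Since \<open>s\<close> does not shorten \<open>a\<close>, exchange takes place in
  \<open>w\<close> and yields \<open>s a = a r\<close> with \<open>r\<close> in \<open>W_I\<close>.
  Lengths add in \<open>a r\<close> while \<open>s\<close> adds only one, so \<open>r\<close> is a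
  single letter. This is the case \<open>s a = a t\<close> of Deodhar's lemma.\<close>

lemma descent_of_min_coset_rep_mult:
  assumes I: "I \<subseteq> S" and a: "a \<in> min_coset_reps W S I" and w: "w \<in> generate W I"
    and s: "s \<in> D (a \<otimes> w)" "s \<notin> D a"
  obtains t where "t \<in> I" "s \<otimes> a = a \<otimes> t"
proof -
  have aW: "a \<in> carrier W" and wW: "w \<in> carrier W" and sS: "s \<in> S"
    using a w I s min_coset_rep_closed generate_closed by (auto simp: descent_iff_less)
  have "len (s \<otimes> a \<otimes> w) < len (a \<otimes> w)"
    using s aW wW sS by (simp add: descent_iff_less m_assoc)
  then obtain w' where w': "w' \<in> generate W I" "s \<otimes> a \<otimes> w = a \<otimes> w'"
    using exchange_mult[OF I sS aW w] s sS by (auto simp: descent_iff_less)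
  have w'W: "w' \<in> carrier W"
    using w' I generate_closed by blast
  define r where "r = w' \<otimes> inv w"
  have r: "r \<in> generate W I" "r \<in> carrier W"
    using w w' generate_subgroup[OF I] generate_closed[OF I]
    by (auto simp: r_def subgroup.m_closed subgroup.m_inv_closed)
  have eq: "s \<otimes> a = a \<otimes> r"
  proof -
    have "s \<otimes> a = s \<otimes> a \<otimes> w \<otimes> inv w"
      using sS aW wW by (simp add: m_assoc)
    then show ?thesis
      using w' aW wW w'W by (simp add: r_def m_assoc)
  qed
  then have "len (s \<otimes> a) = len a + len r"
    using len_min_coset_rep_mult[OF I a r(1)] by simp
  then have "len r = 1"
    using len_gen_mult[OF sS aW] s sS by (auto simp: descent_iff_less)
  moreover obtain us where "us \<in> lists I" "word_prod W us = r" "length us = len r"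
    using r I reduced_word_generate by blast
  ultimately have "r \<in> I"
    using I by (auto simp: length_Suc_conv)
  then show ?thesis
    using eq that by blast
qed

text \<open>The witness is \<open>a\<close> if \<open>s\<close> is already a descent, and
  \<open>a t = s a\<close> otherwise. The last conclusion controls this enlargement: seen from
  \<open>c\<close>, the only first letter that can be gained is the conjugate of \<open>s\<close> by
  \<open>c\<close>.\<close>

lemma descent_of_longest_extension:
  assumes I: "I \<in> finite_type W S" and a: "a \<in> min_coset_reps W S I"
    and s: "s \<in> D (a \<otimes> longest_elem W S I)" and c: "c \<in> carrier W" "c \<preceq> a"
  obtains b where "b \<in> carrier W" "a \<preceq> b" "s \<in> D b" "b \<preceq> a \<otimes> longest_elem W S I"
    "\<And>q. q \<in> D (inv c \<otimes> b) \<Longrightarrow> q \<in> D (inv c \<otimes> a) \<or> s \<otimes> c = c \<otimes> q"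
proof -
  let ?w = "longest_elem W S I"
  have IS: "I \<subseteq> S" and w: "?w \<in> generate W I" "?w \<in> carrier W"
    using I longest_elem_in longest_elem_closed by (auto simp: finite_type_def)
  have aW: "a \<in> carrier W" and sS: "s \<in> S"
    using a s min_coset_rep_closed by (auto simp: descent_iff_less)
  show ?thesis
  proof (cases "s \<in> D a")
    case True
    have "a \<preceq> a \<otimes> ?w"
      using len_min_coset_rep_mult[OF IS a w(1)] aW w by (simp add: weak_le_mult_iff)
    then show ?thesis
      using that[of a] True aW weak_le_refl by blast
  next
    case False
    then obtain t where t: "t \<in> I" "s \<otimes> a = a \<otimes> t"
      using descent_of_min_coset_rep_mult[OF IS a w(1) s] by blast
    then have tS: "t \<in> S" and tg: "t \<in> generate W I"
      using IS by (auto intro: generate.incl)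
    have len: "len (a \<otimes> t) = Suc (len a)"
      using len_min_coset_rep_mult[OF IS a tg] tS by simp
    have "a \<preceq> a \<otimes> t"
      using len aW tS by (simp add: weak_le_mult_iff)
    moreover have "s \<in> D (a \<otimes> t)"
      using len sS aW by (simp add: descent_iff_less flip: t(2))
    moreover have "a \<otimes> t \<preceq> a \<otimes> ?w"
      using weak_le_min_coset_rep_mult[OF IS a tg w(1)] weak_le_longest_elem[OF I tg] .
    moreover have "q \<in> D (inv c \<otimes> a) \<or> s \<otimes> c = c \<otimes> q" if q: "q \<in> D (inv c \<otimes> (a \<otimes> t))" for q
    proof (rule disjCI)
      assume neq: "s \<otimes> c \<noteq> c \<otimes> q"
      show "q \<in> D (inv c \<otimes> a)"
      proof (rule ccontr)
        assume "q \<notin> D (inv c \<otimes> a)"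
        define d where "d = inv c \<otimes> a"
        have d: "d \<in> carrier W" "a = c \<otimes> d"
          using c aW by (simp_all add: d_def)
        have qS: "q \<in> S" and "len (q \<otimes> d \<otimes> t) < len (d \<otimes> t)" "\<not> len (q \<otimes> d) < len d"
          using q \<open>q \<notin> D (inv c \<otimes> a)\<close> c aW tS d(1)
          by (auto simp: descent_iff_less d_def m_assoc)
        \<comment> \<open>As \<open>t\<close> is a single letter, exchange deletes it entirely and
          \<open>q d = d t\<close>. Cancelling \<open>d\<close> in
          \<open>c q d = c d t = s c d\<close> contradicts \<open>neq\<close>.\<close>
        then obtain v where "v \<in> carrier W" "len v < len t" "q \<otimes> d \<otimes> t = d \<otimes> v"
          using exchange_mult[of S q d t] d tS generates by auto
        then have "q \<otimes> d \<otimes> t = d"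
          using tS d by (simp add: len_zero_iff)
        then have "q \<otimes> d = d \<otimes> t"
          using qS d tS by (metis gen_closed gen_square m_assoc m_closed r_one)
        then have "c \<otimes> q \<otimes> d = s \<otimes> c \<otimes> d"
          using t(2) c d qS sS tS by (simp add: m_assoc)
        then show False
          using neq c d qS sS by simp
      qed
    qed
    ultimately show ?thesis
      using that[of "a \<otimes> t"] aW tS by simp
  qed
qed

text \<open>
  If \<open>s\<close> is not below \<open>c = a \<and> b\<close>, enlarge \<open>a\<close> and \<open>b\<close> inside their cosets just enough to lie above
  \<open>s\<close>. Their meet then exceeds \<open>c\<close>, and the first letter \<open>q\<close> by which it does so must conjugate to \<open>s\<close>.
\<close>
lemma descent_below_both_cosets:
  assumes I: "I \<in> finite_type W S" and J: "J \<in> finite_type W S"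
    and a: "a \<in> min_coset_reps W S I" and b: "b \<in> min_coset_reps W S J"
    and s: "s \<in> D (a \<otimes> longest_elem W S I)" "s \<in> D (b \<otimes> longest_elem W S J)"
    and c: "c \<in> carrier W" "c \<preceq> a" "c \<preceq> b"
    and c_greatest: "\<And>u. u \<in> carrier W \<Longrightarrow> u \<preceq> a \<Longrightarrow> u \<preceq> b \<Longrightarrow> u \<preceq> c"
    and not: "s \<notin> D c"
  obtains q where "q \<in> S" "s \<otimes> c = c \<otimes> q" "c \<preceq> c \<otimes> q"
    "c \<otimes> q \<preceq> a \<otimes> longest_elem W S I" "c \<otimes> q \<preceq> b \<otimes> longest_elem W S J"
proof -
  have aW: "a \<in> carrier W" and bW: "b \<in> carrier W"
    and w: "a \<otimes> longest_elem W S I \<in> carrier W" "b \<otimes> longest_elem W S J \<in> carrier W"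
    using a b I J min_coset_rep_closed longest_elem_closed by auto
  obtain a' where a': "a' \<in> carrier W" "a \<preceq> a'" "s \<in> D a'" "a' \<preceq> a \<otimes> longest_elem W S I"
    "\<And>q. q \<in> D (inv c \<otimes> a') \<Longrightarrow> q \<in> D (inv c \<otimes> a) \<or> s \<otimes> c = c \<otimes> q"
    using descent_of_longest_extension[OF I a s(1) c(1,2)] by blast
  obtain b' where b': "b' \<in> carrier W" "b \<preceq> b'" "s \<in> D b'" "b' \<preceq> b \<otimes> longest_elem W S J"
    "\<And>q. q \<in> D (inv c \<otimes> b') \<Longrightarrow> q \<in> D (inv c \<otimes> b) \<or> s \<otimes> c = c \<otimes> q"
    using descent_of_longest_extension[OF J b s(2) c(1,3)] by blast
  obtain m where m: "m \<in> carrier W" "m \<preceq> a'" "m \<preceq> b'"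
    "\<And>u. u \<in> carrier W \<Longrightarrow> u \<preceq> a' \<Longrightarrow> u \<preceq> b' \<Longrightarrow> u \<preceq> m"
    using weak_meet_exists[OF a'(1) b'(1)] by blast
  have sS: "s \<in> S" "s \<in> carrier W"
    using s by (auto simp: descent_iff_less)
  have "s \<preceq> a'" "s \<preceq> b'"
    using a' b' by (auto simp: descent_iff)
  then have "s \<in> D m"
    using m sS by (simp add: descent_iff)
  have ca': "c \<preceq> a'" and cb': "c \<preceq> b'"
    using weak_le_trans[OF c(2) a'(2)] weak_le_trans[OF c(3) b'(2)] c(1) aW bW a'(1) b'(1) by auto
  have cm: "c \<preceq> m"
    using m(4) c(1) ca' cb' by blast
  then obtain n where n: "n \<in> carrier W" "m = c \<otimes> n"
    using c(1) m(1) weak_leE by blast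
  have "n \<noteq> \<one>"
  proof
    assume "n = \<one>"
    then have "m = c"
      using n(2) c(1) by simp
    then show False
      using \<open>s \<in> D m\<close> not by simp
  qed
  then obtain q where q: "q \<in> D n"
    using n descent_exists by blast
  then have qS: "q \<in> S" "q \<preceq> n"
    using n by (auto simp: descent_iff)
  have cq: "c \<otimes> q \<preceq> m" "len (c \<otimes> q) = len c + len q"
    using weak_le_mult_left[of c n q] cm n qS c by auto
  have "n \<preceq> inv c \<otimes> a'" "n \<preceq> inv c \<otimes> b'"
    using weak_le_cancel_left[of c n "inv c \<otimes> a'"] weak_le_cancel_left[of c n "inv c \<otimes> b'"]
      cm m n c a'(1) b'(1) by auto
  then have qa': "q \<in> D (inv c \<otimes> a')" and qb': "q \<in> D (inv c \<otimes> b')"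
    using descent_mono[OF q] n c a'(1) b'(1) by auto
  \<comment> \<open>Otherwise \<open>q\<close> was available on both sides before the enlargement,
    so \<open>c q\<close> lies below \<open>a\<close> and \<open>b\<close>, hence below the shorter
    element \<open>c\<close>.\<close>
  have eq: "s \<otimes> c = c \<otimes> q"
  proof (rule ccontr)
    assume "s \<otimes> c \<noteq> c \<otimes> q"
    then have "q \<in> D (inv c \<otimes> a)" "q \<in> D (inv c \<otimes> b)"
      using a'(5)[OF qa'] b'(5)[OF qb'] by auto
    then have "q \<preceq> inv c \<otimes> a" "q \<preceq> inv c \<otimes> b"
      using c aW bW by (auto simp: descent_iff)
    then have "c \<otimes> q \<preceq> a" "c \<otimes> q \<preceq> b"
      using weak_le_mult_left(1)[of c "inv c \<otimes> a" q] weak_le_mult_left(1)[of c "inv c \<otimes> b" q]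
        c aW bW qS by auto
    then have "c \<otimes> q \<preceq> c"
      using c_greatest c qS by simp
    then show False
      using cq qS by (simp add: weak_le_def)
  qed
  show ?thesis
  proof (rule that[OF qS(1) eq])
    show "c \<preceq> c \<otimes> q"
      using cq c qS by (simp add: weak_le_mult_iff)
    have cqW: "c \<otimes> q \<in> carrier W"
      using c qS by simp
    show "c \<otimes> q \<preceq> a \<otimes> longest_elem W S I"
      using weak_le_trans[OF cq(1) m(2) cqW m(1) a'(1)] weak_le_trans[OF _ a'(4) cqW a'(1) w(1)] by blast
    show "c \<otimes> q \<preceq> b \<otimes> longest_elem W S J"
      using weak_le_trans[OF cq(1) m(3) cqW m(1) b'(1)] weak_le_trans[OF _ b'(4) cqW b'(1) w(2)] by blast
  qed
qed

section \<open>Weak meets and the candidate coset\<close>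

lemma right_weak_order_simps [simp]:
  "carrier (right_weak_order W S) = carrier W"
  "u .=\<^bsub>right_weak_order W S\<^esub> v \<longleftrightarrow> u = v"
  "u \<sqsubseteq>\<^bsub>right_weak_order W S\<^esub> v \<longleftrightarrow> u \<preceq> v"
  by (simp_all add: right_weak_order_def weak_le_def)

lemma lower_semilattice_right_weak_order: "lower_semilattice (right_weak_order W S)"
proof unfold_locales
  fix x y assume "x \<in> carrier (right_weak_order W S)" "y \<in> carrier (right_weak_order W S)"
  then show "\<exists>m. greatest (right_weak_order W S) m (Lower (right_weak_order W S) {x, y})"
    using weak_meet_exists[of x y] by (auto simp: greatest_def Lower_def)
qed (auto simp: fun_eq_iff intro: weak_le_refl weak_le_antisym weak_le_trans)

abbreviation weak_meet :: "'a \<Rightarrow> 'a \<Rightarrow> 'a" where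
  "weak_meet x y \<equiv> x \<sqinter>\<^bsub>right_weak_order W S\<^esub> y"

lemma weak_meet:
  assumes "x \<in> carrier W" "y \<in> carrier W"
  shows weak_meet_closed: "weak_meet x y \<in> carrier W"
    and weak_meet_left: "weak_meet x y \<preceq> x"
    and weak_meet_right: "weak_meet x y \<preceq> y"
    and weak_meet_greatest: "\<And>u. u \<in> carrier W \<Longrightarrow> u \<preceq> x \<Longrightarrow> u \<preceq> y \<Longrightarrow> u \<preceq> weak_meet x y"
proof -
  interpret R: lower_semilattice "right_weak_order W S"
    by (rule lower_semilattice_right_weak_order)
  show "weak_meet x y \<in> carrier W" "weak_meet x y \<preceq> x" "weak_meet x y \<preceq> y"
    "\<And>u. u \<in> carrier W \<Longrightarrow> u \<preceq> x \<Longrightarrow> u \<preceq> y \<Longrightarrow> u \<preceq> weak_meet x y"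
    using assms R.meet_closed[of x y] R.meet_left[of x y] R.meet_right[of x y] R.meet_le[of _ x y]
    by simp_all
qed

abbreviation top_elem :: "'a \<Rightarrow> 'a set \<Rightarrow> 'a" where
  "top_elem x I \<equiv> x \<otimes> longest_elem W S I"

lemma finite_type_subset: "I \<in> finite_type W S \<Longrightarrow> I \<subseteq> S"
  by (simp add: finite_type_def)

lemma top_elem_closed: "I \<in> finite_type W S \<Longrightarrow> x \<in> carrier W \<Longrightarrow> top_elem x I \<in> carrier W"
  by (simp add: longest_elem_closed)

lemma weak_le_top_elem:
  assumes "I \<in> finite_type W S" "x \<in> min_coset_reps W S I"
  shows "x \<preceq> top_elem x I"
  using len_min_coset_rep_mult[OF finite_type_subset[OF assms(1)] assms(2) longest_elem_in[OF assms(1)]]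
    assms by (simp add: weak_le_mult_iff longest_elem_closed min_coset_rep_closed)

context
  fixes I J x y z v K
  assumes I: "I \<in> finite_type W S" and J: "J \<in> finite_type W S"
    and x: "x \<in> min_coset_reps W S I" and y: "y \<in> min_coset_reps W S J"
  defines "z \<equiv> weak_meet x y" and "v \<equiv> weak_meet (top_elem x I) (top_elem y J)"
    and "K \<equiv> D (inv z \<otimes> v)"
begin

lemma meet_carrier:
  "x \<in> carrier W" "y \<in> carrier W" "top_elem x I \<in> carrier W" "top_elem y J \<in> carrier W"
  "z \<in> carrier W" "v \<in> carrier W"
  using I J x y by (auto simp: z_def v_def min_coset_rep_closed top_elem_closed intro!: weak_meet_closed)

lemma meet_bottom_le: "z \<preceq> x" "z \<preceq> y"
  and meet_top_le: "v \<preceq> top_elem x I" "v \<preceq> top_elem y J"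
  unfolding z_def v_def using meet_carrier weak_meet_left weak_meet_right by blast+

lemma meet_bottom_le_top: "z \<preceq> v"
proof -
  have "z \<preceq> top_elem x I" "z \<preceq> top_elem y J"
    using weak_le_trans[OF meet_bottom_le(1) weak_le_top_elem[OF I x]]
      weak_le_trans[OF meet_bottom_le(2) weak_le_top_elem[OF J y]] meet_carrier by auto
  then show ?thesis
    unfolding v_def using meet_carrier weak_meet_greatest by blast
qed

lemma meet_finite_type: "K \<in> finite_type W S"
  by (rule finite_type_descents[of "inv z \<otimes> v"]) (simp_all add: K_def meet_carrier)

text \<open>Each letter of \<open>K\<close> begins \<open>inv z v\<close>, and lengths add in
  \<open>z (inv z v)\<close> because \<open>z\<close> lies below \<open>v\<close>.\<close>

lemma meet_min_coset_rep: "z \<in> min_coset_reps W S K"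
  unfolding min_coset_reps_def
proof (intro CollectI conjI ballI meet_carrier)
  fix s assume "s \<in> K"
  then have s: "s \<in> S" "s \<preceq> inv z \<otimes> v"
    using meet_carrier by (auto simp: K_def descent_iff)
  then have "len (z \<otimes> s) = len z + len s"
    using weak_le_mult_left(2)[of z "inv z \<otimes> v" s] meet_bottom_le_top meet_carrier by simp
  then show "len z < len (z \<otimes> s)"
    using s by simp
qed

lemma meet_top_elem_le: "top_elem z K \<preceq> v"
proof -
  have "longest_elem W S K \<preceq> inv z \<otimes> v"
    using generate_weak_le[of "inv z \<otimes> v" K] longest_elem_in[OF meet_finite_type] meet_carrier
    by (simp add: K_def)
  then show ?thesis
    using weak_le_mult_left(1)[of z "inv z \<otimes> v" "longest_elem W S K"] meet_bottom_le_top
      meet_carrier longest_elem_closed[OF meet_finite_type] by simp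
qed

text \<open>
  Write \<open>x = u a\<close>, \<open>y = u b\<close>, \<open>z = u c\<close>. It suffices that each \<open>s \<in> L\<close> is a descent of \<open>c w\<^sub>K\<close>:
  either \<open>s \<preceq> c\<close>, or \<open>s c = c q\<close> with \<open>q \<in> K\<close>.
\<close>
lemma meet_top_elem_greatest:
  assumes L: "L \<in> finite_type W S" and u: "u \<in> min_coset_reps W S L"
    and ux: "u \<preceq> x" and uy: "u \<preceq> y"
    and top: "top_elem u L \<preceq> top_elem x I" "top_elem u L \<preceq> top_elem y J"
  shows "top_elem u L \<preceq> top_elem z K"
proof -
  note [simp] = meet_carrier longest_elem_closed[OF meet_finite_type] longest_elem_closed[OF L]
    longest_elem_closed[OF I] longest_elem_closed[OF J]
  have uW [simp]: "u \<in> carrier W"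
    using u by (rule min_coset_rep_closed)
  have uz: "u \<preceq> z"
    unfolding z_def using weak_meet_greatest ux uy by simp
  define a b c where abc: "a = inv u \<otimes> x" "b = inv u \<otimes> y" "c = inv u \<otimes> z"
  have [simp]: "a \<in> carrier W" "b \<in> carrier W" "c \<in> carrier W"
    by (simp_all add: abc)
  have eqs: "x = u \<otimes> a" "y = u \<otimes> b" "z = u \<otimes> c"
    by (simp_all add: abc)
  have le: "u \<preceq> u \<otimes> a" "u \<preceq> u \<otimes> b" "u \<preceq> u \<otimes> c"
    using ux uy uz by (simp_all flip: eqs)
  have a: "a \<in> min_coset_reps W S I" and b: "b \<in> min_coset_reps W S J"
    using min_coset_rep_suffix[OF le(1) _ finite_type_subset[OF I]]
      min_coset_rep_suffix[OF le(2) _ finite_type_subset[OF J]] x y by (simp_all flip: eqs)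
  have tops: "top_elem x I = u \<otimes> top_elem a I" "top_elem y J = u \<otimes> top_elem b J"
    "top_elem z K = u \<otimes> top_elem c K"
    by (simp_all add: eqs m_assoc)
  have u_top: "u \<preceq> top_elem u L"
    using weak_le_top_elem[OF L u] .
  have uab: "u \<preceq> u \<otimes> top_elem a I" "u \<preceq> u \<otimes> top_elem b J"
    using weak_le_trans[OF u_top top(1)] weak_le_trans[OF u_top top(2)] by (simp_all flip: tops)
  have ca: "c \<preceq> a" "c \<preceq> b"
    using weak_le_cancel_left[OF le(3), of a] weak_le_cancel_left[OF le(3), of b] meet_bottom_le
    by (simp_all flip: eqs)
  \<comment> \<open>Removing the common prefix \<open>u\<close> turns the meet \<open>z\<close> of
    \<open>x\<close> and \<open>y\<close> into the meet \<open>c\<close> of \<open>a\<close> and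
    \<open>b\<close>.\<close>
  have c_greatest: "d \<preceq> c" if d: "d \<in> carrier W" "d \<preceq> a" "d \<preceq> b" for d
  proof -
    have "u \<otimes> d \<preceq> x" "u \<otimes> d \<preceq> y" "u \<preceq> u \<otimes> d"
      using weak_le_mult_left[OF le(1) d(2)] weak_le_mult_left[OF le(2) d(3)] d(1)
      by (simp_all add: weak_le_mult_iff flip: eqs)
    moreover from this have "u \<otimes> d \<preceq> z"
      unfolding z_def using weak_meet_greatest d by simp
    ultimately show ?thesis
      using weak_le_cancel_left[of u d c] d by (simp flip: eqs)
  qed
  have w_le: "longest_elem W S L \<preceq> top_elem a I" "longest_elem W S L \<preceq> top_elem b J"
    using weak_le_cancel_left[OF u_top, of "top_elem a I"] weak_le_cancel_left[OF u_top, of "top_elem b J"]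
      top by (simp_all flip: tops)
  have zK: "len (top_elem z K) = len z + len (longest_elem W S K)"
    using weak_le_top_elem[OF meet_finite_type meet_min_coset_rep] by (simp add: weak_le_mult_iff)
  have len_z: "len z = len u + len c"
    using le(3) unfolding eqs(3) by (simp add: weak_le_mult_iff)
  have ucK: "len (u \<otimes> top_elem c K) = len u + len c + len (longest_elem W S K)"
    using zK len_z unfolding tops(3) by simp
  then have cK: "len (top_elem c K) = len c + len (longest_elem W S K)"
    using len_mult_le[of u "top_elem c K"] len_mult_le[of c "longest_elem W S K"] by simp
  have u_zK: "u \<preceq> u \<otimes> top_elem c K"
    using ucK cK by (simp add: weak_le_mult_iff)
  have "L \<subseteq> D (top_elem c K)"
  proof
    fix s assume "s \<in> L"
    then have "s \<in> D (longest_elem W S L)"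
      using descents_longest_elem[OF L] by simp
    then have s: "s \<in> D (top_elem a I)" "s \<in> D (top_elem b J)" "s \<in> S"
      using descent_mono[of s "longest_elem W S L"] w_le by (auto simp: descent_iff_less)
    have sW: "s \<in> carrier W"
      using s(3) by simp
    show "s \<in> D (top_elem c K)"
    proof (cases "s \<in> D c")
      case True
      then show ?thesis
        using descent_mono[of s c "top_elem c K"] cK by (simp add: weak_le_mult_iff)
    next
      case False
      obtain q where q: "q \<in> S" "s \<otimes> c = c \<otimes> q" "c \<preceq> c \<otimes> q"
        "c \<otimes> q \<preceq> top_elem a I" "c \<otimes> q \<preceq> top_elem b J"
        using descent_below_both_cosets[OF I J a b s(1,2) _ ca c_greatest False] by auto
      have qW: "q \<in> carrier W"
        using q(1) by simp
      have zq: "u \<otimes> (c \<otimes> q) = z \<otimes> q"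
        using qW by (simp add: eqs m_assoc)
      \<comment> \<open>With \<open>u\<close> restored, \<open>z q\<close> lies below both tops and
        hence below \<open>v\<close>; so \<open>q\<close> begins \<open>inv z v\<close>, which is
        membership in \<open>K\<close>.\<close>
      have "z \<otimes> q \<preceq> top_elem x I" "z \<otimes> q \<preceq> top_elem y J"
        and len_zq: "len (z \<otimes> q) = len u + len (c \<otimes> q)"
        using weak_le_mult_left[OF uab(1) q(4)] weak_le_mult_left[OF uab(2) q(5)] qW
        by (simp_all add: zq flip: tops)
      then have "z \<otimes> q \<preceq> v"
        unfolding v_def using weak_meet_greatest qW by simp
      moreover have "z \<preceq> z \<otimes> q"
        using len_zq len_z q(3) qW by (simp add: weak_le_mult_iff)
      ultimately have "q \<preceq> inv z \<otimes> v"
        using weak_le_cancel_left[of z q "inv z \<otimes> v"] qW by simp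
      then have "q \<in> K"
        using q(1) by (simp add: K_def descent_iff)
      then have "len (q \<otimes> longest_elem W S K) < len (longest_elem W S K)"
        using descents_longest_elem[OF meet_finite_type] by (auto simp: descent_iff_less)
      \<comment> \<open>Moved past \<open>c\<close>, the letter \<open>s\<close> becomes
        \<open>q\<close> and shortens the longest element of \<open>W_K\<close>; as lengths add in
        \<open>c w_K\<close>, the whole product becomes shorter.\<close>
      moreover have "s \<otimes> top_elem c K = c \<otimes> (q \<otimes> longest_elem W S K)"
        using q(2) sW qW by (simp flip: m_assoc)
      ultimately show ?thesis
        using cK s(3) qW len_mult_le[of c "q \<otimes> longest_elem W S K"] by (simp add: descent_iff_less)
    qed
  qed
  then have "longest_elem W S L \<preceq> top_elem c K"
    using generate_weak_le[of "top_elem c K" L] longest_elem_in[OF L] by simp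
  then show ?thesis
    using weak_le_mult_left(1)[OF u_zK] by (simp add: tops)
qed

end

section \<open>The facial weak order as a semilattice\<close>

lemma facial_weak_order_simps [simp]:
  "carrier (facial_weak_order W S) = davis_complex W S"
  "A .=\<^bsub>facial_weak_order W S\<^esub> B \<longleftrightarrow> A = B"
  by (simp_all add: facial_weak_order_def)

text \<open>Uniqueness of minimal representatives removes the existential quantifiers, so an
  inequality can be tested on the presentations at hand.\<close>

lemma facial_le_iff:
  assumes "I \<in> finite_type W S" "J \<in> finite_type W S"
    and "x \<in> min_coset_reps W S I" "y \<in> min_coset_reps W S J"
  shows "x <# generate W I \<sqsubseteq>\<^bsub>facial_weak_order W S\<^esub> y <# generate W J \<longleftrightarrow>
    x \<preceq> y \<and> top_elem x I \<preceq> top_elem y J" (is "?L \<longleftrightarrow> ?R")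
proof
  assume ?L
  then have "\<exists>I' \<in> finite_type W S. \<exists>J' \<in> finite_type W S.
      \<exists>x' \<in> min_coset_reps W S I'. \<exists>y' \<in> min_coset_reps W S J'.
        x <# generate W I = x' <# generate W I' \<and> y <# generate W J = y' <# generate W J' \<and>
        x' \<preceq> y' \<and> top_elem x' I' \<preceq> top_elem y' J'"
    unfolding facial_weak_order_def gorder.simps right_weak_order_simps .
  then obtain I' J' x' y' where *: "I' \<in> finite_type W S" "J' \<in> finite_type W S"
    "x' \<in> min_coset_reps W S I'" "y' \<in> min_coset_reps W S J'"
    "x <# generate W I = x' <# generate W I'" "y <# generate W J = y' <# generate W J'"
    "x' \<preceq> y'" "top_elem x' I' \<preceq> top_elem y' J'"
    by (elim bexE conjE)
  have "x = x' \<and> I = I'"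
    by (rule min_coset_rep_unique[OF finite_type_subset finite_type_subset]) (fact assms *)+
  moreover have "y = y' \<and> J = J'"
    by (rule min_coset_rep_unique[OF finite_type_subset finite_type_subset]) (fact assms *)+
  ultimately show ?R
    using *(7,8) by blast
next
  assume ?R
  then show ?L
    unfolding facial_weak_order_def gorder.simps right_weak_order_simps using assms by blast
qed

lemma facial_meet_greatest:
  assumes I: "I \<in> finite_type W S" and J: "J \<in> finite_type W S"
    and x: "x \<in> min_coset_reps W S I" and y: "y \<in> min_coset_reps W S J"
    and z: "z = weak_meet x y" and K: "K = D (inv z \<otimes> weak_meet (top_elem x I) (top_elem y J))"
  shows "greatest (facial_weak_order W S) (z <# generate W K)
    (Lower (facial_weak_order W S) {x <# generate W I, y <# generate W J})"
proof -
  note m = meet_carrier[OF I J x y, folded z] meet_bottom_le[OF I J x y, folded z]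
    meet_top_le[OF I J x y]
  note Kf = meet_finite_type[OF I J x y, folded z, folded K]
  note zK = meet_min_coset_rep[OF I J x y, folded z, folded K]
  note top = meet_top_elem_le[OF I J x y, folded z, folded K]
  note great = meet_top_elem_greatest[OF I J x y, folded z, folded K]
  have "top_elem z K \<preceq> top_elem x I" "top_elem z K \<preceq> top_elem y J"
    using weak_le_trans[OF top m(9)] weak_le_trans[OF top m(10)] m top_elem_closed[OF Kf] by auto
  then have "z <# generate W K \<sqsubseteq>\<^bsub>facial_weak_order W S\<^esub> x <# generate W I"
    "z <# generate W K \<sqsubseteq>\<^bsub>facial_weak_order W S\<^esub> y <# generate W J"
    using facial_le_iff[OF Kf I zK x] facial_le_iff[OF Kf J zK y] m by blast+
  moreover have "A \<sqsubseteq>\<^bsub>facial_weak_order W S\<^esub> z <# generate W K"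
    if A: "A \<in> davis_complex W S" "A \<sqsubseteq>\<^bsub>facial_weak_order W S\<^esub> x <# generate W I"
      "A \<sqsubseteq>\<^bsub>facial_weak_order W S\<^esub> y <# generate W J" for A
  proof -
    obtain L u where L: "L \<in> finite_type W S" and u: "u \<in> min_coset_reps W S L"
      and A_eq: "A = u <# generate W L"
      using davis_complex_min_rep A(1) by blast
    have le: "u \<preceq> x" "u \<preceq> y" "top_elem u L \<preceq> top_elem x I" "top_elem u L \<preceq> top_elem y J"
      using A(2,3) facial_le_iff[OF L I u x] facial_le_iff[OF L J u y] unfolding A_eq by blast+
    have "u \<preceq> z"
      unfolding z using weak_meet_greatest m le min_coset_rep_closed[OF u] by blast
    then show ?thesis
      using great[OF L u le] facial_le_iff[OF L Kf u zK] unfolding A_eq by blast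
  qed
  ultimately show ?thesis
    using coset_in_davis_complex[OF Kf] coset_in_davis_complex[OF I] coset_in_davis_complex[OF J] m
    by (auto simp: greatest_def Lower_def)
qed

lemma lower_semilattice_facial_weak_order: "lower_semilattice (facial_weak_order W S)"
proof unfold_locales
  let ?F = "facial_weak_order W S"
  fix A assume "A \<in> carrier ?F"
  then obtain I x where "I \<in> finite_type W S" "x \<in> min_coset_reps W S I" "A = x <# generate W I"
    using davis_complex_min_rep by auto
  then show "A \<sqsubseteq>\<^bsub>?F\<^esub> A"
    by (simp add: facial_le_iff weak_le_refl min_coset_rep_closed top_elem_closed)
next
  let ?F = "facial_weak_order W S"
  fix A B assume AB: "A \<in> carrier ?F" "B \<in> carrier ?F" "A \<sqsubseteq>\<^bsub>?F\<^esub> B" "B \<sqsubseteq>\<^bsub>?F\<^esub> A"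
  obtain I x where I: "I \<in> finite_type W S" and x: "x \<in> min_coset_reps W S I"
    and A: "A = x <# generate W I"
    using AB(1,2) davis_complex_min_rep by auto
  obtain J y where J: "J \<in> finite_type W S" and y: "y \<in> min_coset_reps W S J"
    and B: "B = y <# generate W J"
    using AB(1,2) davis_complex_min_rep by auto
  have c: "x \<in> carrier W" "y \<in> carrier W" "longest_elem W S I \<in> carrier W" "longest_elem W S J \<in> carrier W"
    using I J x y min_coset_rep_closed longest_elem_closed by blast+
  have "x \<preceq> y" "y \<preceq> x" "top_elem x I \<preceq> top_elem y J" "top_elem y J \<preceq> top_elem x I"
    using AB(3,4) facial_le_iff[OF I J x y] facial_le_iff[OF J I y x] unfolding A B by blast+
  then have "x = y" "top_elem x I = top_elem y J"
    using weak_le_antisym c by simp_all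
  \<comment> \<open>Equal bottoms and tops leave equal longest elements, whose descent sets are
    \<open>I\<close> and \<open>J\<close>.\<close>
  then have "longest_elem W S I = longest_elem W S J"
    using c by simp
  then have "I = J"
    using descents_longest_elem[OF I] descents_longest_elem[OF J] by argo
  then show "A .=\<^bsub>?F\<^esub> B"
    using \<open>x = y\<close> A B by simp
next
  let ?F = "facial_weak_order W S"
  fix A B C assume ABC: "A \<in> carrier ?F" "B \<in> carrier ?F" "C \<in> carrier ?F"
    "A \<sqsubseteq>\<^bsub>?F\<^esub> B" "B \<sqsubseteq>\<^bsub>?F\<^esub> C"
  obtain I x where I: "I \<in> finite_type W S" and x: "x \<in> min_coset_reps W S I"
    and A: "A = x <# generate W I"
    using ABC(1-3) davis_complex_min_rep by auto
  obtain J y where J: "J \<in> finite_type W S" and y: "y \<in> min_coset_reps W S J"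
    and B: "B = y <# generate W J"
    using ABC(1-3) davis_complex_min_rep by auto
  obtain L u where L: "L \<in> finite_type W S" and u: "u \<in> min_coset_reps W S L"
    and C: "C = u <# generate W L"
    using ABC(1-3) davis_complex_min_rep by auto
  have c: "x \<in> carrier W" "y \<in> carrier W" "u \<in> carrier W"
    "top_elem x I \<in> carrier W" "top_elem y J \<in> carrier W" "top_elem u L \<in> carrier W"
    using I J L x y u by (simp_all add: min_coset_rep_closed top_elem_closed)
  have "x \<preceq> y" "y \<preceq> u" "top_elem x I \<preceq> top_elem y J" "top_elem y J \<preceq> top_elem u L"
    using ABC(4,5) facial_le_iff[OF I J x y] facial_le_iff[OF J L y u] unfolding A B C by blast+
  then have "x \<preceq> u" "top_elem x I \<preceq> top_elem u L"
    using weak_le_trans[of x y u] weak_le_trans[of "top_elem x I" "top_elem y J" "top_elem u L"] c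
    by auto
  then show "A \<sqsubseteq>\<^bsub>?F\<^esub> C"
    using facial_le_iff[OF I L x u] unfolding A C by blast
next
  let ?F = "facial_weak_order W S"
  fix A B assume AB: "A \<in> carrier ?F" "B \<in> carrier ?F"
  obtain I x where I: "I \<in> finite_type W S" and x: "x \<in> min_coset_reps W S I"
    and A: "A = x <# generate W I"
    using AB(1,2) davis_complex_min_rep by auto
  obtain J y where J: "J \<in> finite_type W S" and y: "y \<in> min_coset_reps W S J"
    and B: "B = y <# generate W J"
    using AB(1,2) davis_complex_min_rep by auto
  show "\<exists>M. greatest ?F M (Lower ?F {A, B})"
    using facial_meet_greatest[OF I J x y HOL.refl HOL.refl] A B by blast
qed (simp_all add: fun_eq_iff)

lemma facial_meet_eq:
  assumes "I \<in> finite_type W S" "J \<in> finite_type W S"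
    and "x \<in> min_coset_reps W S I" "y \<in> min_coset_reps W S J"
    and "z = weak_meet x y" "K = D (inv z \<otimes> weak_meet (top_elem x I) (top_elem y J))"
  shows "(x <# generate W I) \<sqinter>\<^bsub>facial_weak_order W S\<^esub> (y <# generate W J) = z <# generate W K"
proof -
  interpret F: lower_semilattice "facial_weak_order W S"
    by (rule lower_semilattice_facial_weak_order)
  have "x <# generate W I \<in> carrier (facial_weak_order W S)"
    "y <# generate W J \<in> carrier (facial_weak_order W S)"
    using assms by (auto simp: coset_in_davis_complex min_coset_rep_closed)
  then show ?thesis
    unfolding meet_def
    by (intro F.greatest_unique[OF _ facial_meet_greatest[OF assms]] F.inf_of_two_greatest)
qed

end

theorem theorem3p30:
  fixes W :: "('a, 'b) monoid_scheme" and S :: "'a set"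
  assumes "coxeter_system W S"
  shows "lower_semilattice (facial_weak_order W S) \<and>
    (\<forall>I \<in> finite_type W S. \<forall>J \<in> finite_type W S.
       \<forall>x \<in> min_coset_reps W S I. \<forall>y \<in> min_coset_reps W S J.
         let z = x \<sqinter>\<^bsub>right_weak_order W S\<^esub> y;
             K = left_descents W S
                   (inv\<^bsub>W\<^esub> z \<otimes>\<^bsub>W\<^esub>
                      ((x \<otimes>\<^bsub>W\<^esub> longest_elem W S I) \<sqinter>\<^bsub>right_weak_order W S\<^esub>
                       (y \<otimes>\<^bsub>W\<^esub> longest_elem W S J)))
         in K \<in> finite_type W S \<and> z \<in> min_coset_reps W S K \<and>
            (x <#\<^bsub>W\<^esub> generate W I) \<sqinter>\<^bsub>facial_weak_order W S\<^esub> (y <#\<^bsub>W\<^esub> generate W J)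
              = z <#\<^bsub>W\<^esub> generate W K)"
proof -
  interpret coxeter_system W S by (rule assms)
  show ?thesis
    unfolding Let_def
    by (intro conjI ballI lower_semilattice_facial_weak_order meet_finite_type meet_min_coset_rep
        facial_meet_eq HOL.refl)
qed

end
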